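(* Let $T_1$ and $T_2$ be homogeneous operators in $\mathrm B_n(\mathbb D)$. Then $\mathcal K_{T_1}(0)$ and $(\mathcal K_{T_1})_{\bar z}(0)$ are simultaneously unitarily equivalent to $\mathcal K_{T_2}(0)$ and $(\mathcal K_{T_2})_{\bar z}(0)$ respectively if and only if, for every $z\in\mathbb D$, $\mathcal K_{T_1}(z)$ and $(\mathcal K_{T_1})_{\bar z}(z)$ are simultaneously unitarily equivalent to $\mathcal K_{T_2}(z)$ and $(\mathcal K_{T_2})_{\bar z}(z)$ respectively.
   Context: $\mathbb D$ is the open unit disc in $\mathbb C$. For an open connected set $\Omega\subset\mathbb C$ and a positive integer $n$, $\mathrm B_n(\Omega)$ is the class of bounded operators $T$ on a complex separable Hilbert space $\mathcal H$ such that $\Omega\subset\sigma(T)$, $\mathrm{ran}(T-\omega)=\mathcal H$ for $\omega\in\Omega$, the closed linear span of $\bigcup_{\omega\in\Omega}\ker(T-\omega)$ is $\mathcal H$, and $\dim\ker(T-\omega)=n$ for $\omega\in\Omega$. The eigenspaces form a Hermitian holomorphic vector bundle $E_T=\{(\omega,x)\in\Omega\times\mathcal H: x\in\ker(T-\omega)\}$ of rank $n$, the fibre at $\omega$ carrying the inner product of $\mathcal H$. With respect to a local holomorphic frame $(\gamma_1,\dots,\gamma_n)$ with Gram matrix $h(\omega)=(\langle\gamma_j(\omega),\gamma_i(\omega)\rangle)_{i,j}$, the curvature $\mathcal K_T$ is the bundle endomorphism with matrix $\bar\partial(h^{-1}\partial h)$, and for a bundle endomorphism $\Theta$ (identified with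 its matrix in the frame) the covariant derivative $\Theta_{\bar z}$ is the bundle endomorphism with matrix $\bar\partial\Theta$. So $\mathcal K_T(z)$ and $(\mathcal K_T)_{\bar z}(z)$ are linear operators on the finite-dimensional Hilbert space $\ker(T-z)$. Pairs of operators $(A_1,A_2)$ on a Hilbert space $V$ and $(B_1,B_2)$ on a Hilbert space $W$ are simultaneously unitarily equivalent if there is a single unitary $U:V\to W$ with $UA_i=B_iU$ for $i=1,2$. An operator $T$ (with $\sigma(T)\subset\overline{\mathbb D}$) is homogeneous if $\varphi(T)$ is unitarily equivalent to $T$ for every biholomorphic automorphism $\varphi$ of $\mathbb D$. *)

theory Defs
  imports "HOL-Complex_Analysis.Complex_Analysis"
begin

section \<open>Complex Hilbert spaces\<close>

text \<open>
  The norm, metric and topology are those of the underlying real inner product space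
  (the real inner product being the real part of the complex one), so that the analysis
  library applies directly. The complex inner product is linear in its \<^emph>\<open>first\<close> argument;
  this is what makes the matrix \<open>h\<^sup>-\<^sup>1 \<partial>h\<close> below the connection matrix of the bundle.
\<close>

class chilbert_space = real_inner + complete_space +
  fixes scaleC :: "complex \<Rightarrow> 'a \<Rightarrow> 'a" (infixr "*\<^sub>C" 75)
    and cinner :: "'a \<Rightarrow> 'a \<Rightarrow> complex"
  assumes scaleC_add_right: "c *\<^sub>C (x + y) = c *\<^sub>C x + c *\<^sub>C y"
    and scaleC_add_left: "(c + d) *\<^sub>C x = c *\<^sub>C x + d *\<^sub>C x"
    and scaleC_scaleC: "c *\<^sub>C d *\<^sub>C x = (c * d) *\<^sub>C x"
    and scaleC_one: "1 *\<^sub>C x = x"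
    and scaleC_of_real: "complex_of_real r *\<^sub>C x = r *\<^sub>R x"
    and cinner_commute: "cinner x y = cnj (cinner y x)"
    and cinner_add_left: "cinner (x + y) z = cinner x z + cinner y z"
    and cinner_scaleC_left: "cinner (c *\<^sub>C x) y = c * cinner x y"
    and Re_cinner: "Re (cinner x y) = inner x y"

global_interpretation complex_vector:
  vector_space "scaleC :: complex \<Rightarrow> 'a \<Rightarrow> 'a::chilbert_space"
  by unfold_locales (simp_all add: scaleC_add_right scaleC_add_left scaleC_scaleC scaleC_one)


section \<open>Bounded operators, spectrum, unitary equivalence\<close>

definition bounded_clinear :: "('a::chilbert_space \<Rightarrow> 'b::chilbert_space) \<Rightarrow> bool" where
  "bounded_clinear T \<longleftrightarrow> bounded_linear T \<and> (\<forall>c x. T (c *\<^sub>C x) = c *\<^sub>C T x)"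

definition shift :: "('a::chilbert_space \<Rightarrow> 'a) \<Rightarrow> complex \<Rightarrow> 'a \<Rightarrow> 'a" where
  "shift T w = (\<lambda>x. T x - w *\<^sub>C x)"

definition spectrum :: "('a::chilbert_space \<Rightarrow> 'a) \<Rightarrow> complex set" where
  "spectrum T = {w. \<not> (\<exists>S. bounded_clinear S \<and> S \<circ> shift T w = id \<and> shift T w \<circ> S = id)}"

definition eigenspace :: "('a::chilbert_space \<Rightarrow> 'a) \<Rightarrow> complex \<Rightarrow> 'a set" where
  "eigenspace T w = {x. shift T w x = 0}"

definition unitary_between ::
  "'a::chilbert_space set \<Rightarrow> 'b::chilbert_space set \<Rightarrow> ('a \<Rightarrow> 'b) \<Rightarrow> bool" where
  "unitary_between V W U \<longleftrightarrow>
     (\<forall>x\<in>V. \<forall>y\<in>V. U (x + y) = U x + U y) \<and>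
     (\<forall>c. \<forall>x\<in>V. U (c *\<^sub>C x) = c *\<^sub>C U x) \<and>
     U ` V = W \<and>
     (\<forall>x\<in>V. \<forall>y\<in>V. cinner (U x) (U y) = cinner x y)"

definition unitarily_equivalent ::
  "('a::chilbert_space \<Rightarrow> 'a) \<Rightarrow> ('b::chilbert_space \<Rightarrow> 'b) \<Rightarrow> bool" where
  "unitarily_equivalent S T \<longleftrightarrow> (\<exists>U. unitary_between UNIV UNIV U \<and> (\<forall>x. U (S x) = T (U x)))"

definition simultaneously_unitarily_equivalent ::
  "'a::chilbert_space set \<Rightarrow> ('a \<Rightarrow> 'a) \<Rightarrow> ('a \<Rightarrow> 'a) \<Rightarrow>
   'b::chilbert_space set \<Rightarrow> ('b \<Rightarrow> 'b) \<Rightarrow> ('b \<Rightarrow> 'b) \<Rightarrow> bool" where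
  "simultaneously_unitarily_equivalent V A1 A2 W B1 B2 \<longleftrightarrow>
     (\<exists>U. unitary_between V W U \<and> (\<forall>x\<in>V. U (A1 x) = B1 (U x) \<and> U (A2 x) = B2 (U x)))"


section \<open>The Cowen-Douglas class\<close>

text \<open>The set \<open>\<Omega>\<close> is meant to be open and connected.\<close>

definition cowen_douglas :: "nat \<Rightarrow> complex set \<Rightarrow> ('a::chilbert_space \<Rightarrow> 'a) set" where
  "cowen_douglas n \<Omega> = {T. bounded_clinear T \<and> 0 < n \<and>
     separable_space (euclidean :: 'a topology) \<and>
     \<Omega> \<subseteq> spectrum T \<and>
     (\<forall>w\<in>\<Omega>. range (shift T w) = UNIV) \<and>
     closure (complex_vector.span (\<Union>w\<in>\<Omega>. eigenspace T w)) = UNIV \<and>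
     (\<forall>w\<in>\<Omega>. complex_vector.dim (eigenspace T w) = n)}"


section \<open>Homogeneous operators\<close>

definition disc_automorphism :: "(complex \<Rightarrow> complex) \<Rightarrow> bool" where
  "disc_automorphism \<phi> \<longleftrightarrow> \<phi> holomorphic_on ball 0 1 \<and> bij_betw \<phi> (ball 0 1) (ball 0 1) \<and>
     inv_into (ball 0 1) \<phi> holomorphic_on ball 0 1"

text \<open>
  The holomorphic functional calculus on a disc: \<open>S = f(T)\<close> is the sum, in operator norm, of
  the Taylor series of \<open>f\<close> at the origin, evaluated at \<open>T\<close>. An automorphism of the unit disc
  extends holomorphically to a disc of radius greater than 1, so if the spectrum of \<open>T\<close> lies in
  the closed unit disc the series converges (the spectral radius of \<open>T\<close> is at most 1) and
  \<open>f(T)\<close> is the operator given by the Riesz-Dunford integral.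
\<close>

definition is_functional_calculus ::
  "(complex \<Rightarrow> complex) \<Rightarrow> ('a::chilbert_space \<Rightarrow> 'a) \<Rightarrow> ('a \<Rightarrow> 'a) \<Rightarrow> bool" where
  "is_functional_calculus f T S \<longleftrightarrow> bounded_clinear S \<and>
     (\<lambda>N. onorm (\<lambda>x. (\<Sum>k<N. ((deriv ^^ k) f 0 / fact k) *\<^sub>C (T ^^ k) x) - S x)) \<longlonglongrightarrow> 0"

definition homogeneous :: "('a::chilbert_space \<Rightarrow> 'a) \<Rightarrow> bool" where
  "homogeneous T \<longleftrightarrow> bounded_clinear T \<and> spectrum T \<subseteq> cball 0 1 \<and>
     (\<forall>\<phi>. disc_automorphism \<phi> \<longrightarrow>
        (\<exists>S. is_functional_calculus \<phi> T S \<and> unitarily_equivalent S T))"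


section \<open>Curvature of the eigenspace bundle\<close>

definition wirtinger_d :: "(complex \<Rightarrow> complex) \<Rightarrow> complex \<Rightarrow> complex" where
  "wirtinger_d f z =
     (frechet_derivative f (at z) 1 - \<i> * frechet_derivative f (at z) \<i>) / 2"

definition wirtinger_dbar :: "(complex \<Rightarrow> complex) \<Rightarrow> complex \<Rightarrow> complex" where
  "wirtinger_dbar f z =
     (frechet_derivative f (at z) 1 + \<i> * frechet_derivative f (at z) \<i>) / 2"

definition matrix_d :: "(complex \<Rightarrow> complex^'n^'n) \<Rightarrow> complex \<Rightarrow> complex^'n^'n" where
  "matrix_d A z = (\<chi> i j. wirtinger_d (\<lambda>w. A w $ i $ j) z)"

definition matrix_dbar :: "(complex \<Rightarrow> complex^'n^'n) \<Rightarrow> complex \<Rightarrow> complex^'n^'n" where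
  "matrix_dbar A z = (\<chi> i j. wirtinger_dbar (\<lambda>w. A w $ i $ j) z)"

definition holomorphic_vec_on :: "(complex \<Rightarrow> 'a::chilbert_space) \<Rightarrow> complex set \<Rightarrow> bool" where
  "holomorphic_vec_on f U \<longleftrightarrow> (\<forall>z\<in>U. \<exists>d. (f has_derivative (\<lambda>h. h *\<^sub>C d)) (at z within U))"

text \<open>
  A holomorphic frame, over some open neighbourhood of \<open>z\<close> in \<open>\<Omega>\<close>, of the bundle over \<open>\<Omega>\<close>
  with fibre \<open>eigenspace T w\<close> at \<open>w\<close>. The rank of the bundle is the cardinality of the type
  \<open>'n\<close> indexing the frame.
\<close>

definition local_frame ::
  "complex set \<Rightarrow> ('a::chilbert_space \<Rightarrow> 'a) \<Rightarrow> complex \<Rightarrow> ('n::finite \<Rightarrow> complex \<Rightarrow> 'a) \<Rightarrow> bool" where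
  "local_frame \<Omega> T z \<gamma> \<longleftrightarrow> (\<exists>U. open U \<and> z \<in> U \<and> U \<subseteq> \<Omega> \<and>
     (\<forall>i. holomorphic_vec_on (\<gamma> i) U) \<and>
     (\<forall>w\<in>U. inj (\<lambda>i. \<gamma> i w) \<and>
        complex_vector.independent (range (\<lambda>i. \<gamma> i w)) \<and>
        complex_vector.span (range (\<lambda>i. \<gamma> i w)) = eigenspace T w))"

definition gram :: "('n::finite \<Rightarrow> complex \<Rightarrow> 'a::chilbert_space) \<Rightarrow> complex \<Rightarrow> complex^'n^'n" where
  "gram \<gamma> w = (\<chi> i j. cinner (\<gamma> j w) (\<gamma> i w))"

definition curvature_matrix ::
  "('n::finite \<Rightarrow> complex \<Rightarrow> 'a::chilbert_space) \<Rightarrow> complex \<Rightarrow> complex^'n^'n" where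
  "curvature_matrix \<gamma> = matrix_dbar (\<lambda>w. matrix_inv (gram \<gamma> w) ** matrix_d (gram \<gamma>) w)"

text \<open>
  The operator on the fibre at \<open>z\<close> whose matrix in the basis \<open>\<gamma> _ z\<close> is \<open>M\<close>, i.e. it maps
  \<open>\<gamma> j z\<close> to \<open>\<Sum>i. M $ i $ j *\<^sub>C \<gamma> i z\<close>. (Its value outside the fibre is 0.)
\<close>

definition frame_operator ::
  "('n::finite \<Rightarrow> complex \<Rightarrow> 'a::chilbert_space) \<Rightarrow> complex \<Rightarrow> complex^'n^'n \<Rightarrow> 'a \<Rightarrow> 'a" where
  "frame_operator \<gamma> z M x =
     (\<Sum>i\<in>UNIV. \<Sum>j\<in>UNIV.
        (M $ i $ j * complex_vector.representation (range (\<lambda>k. \<gamma> k z)) x (\<gamma> j z)) *\<^sub>C \<gamma> i z)"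

text \<open>
  The curvature of the eigenspace bundle at \<open>z\<close> and its covariant derivative with respect to
  \<open>cnj z\<close>, as operators on \<open>eigenspace T z\<close>. Both are computed in some local holomorphic frame
  around \<open>z\<close>; a change of frame is holomorphic, so that the resulting operators do not depend
  on the frame. The first argument only serves to fix the rank of the bundle.
\<close>

definition curvature ::
  "'n::finite itself \<Rightarrow> complex set \<Rightarrow> ('a::chilbert_space \<Rightarrow> 'a) \<Rightarrow> complex \<Rightarrow> 'a \<Rightarrow> 'a" where
  "curvature N \<Omega> T z =
     (let \<gamma> = (SOME \<gamma> :: 'n \<Rightarrow> complex \<Rightarrow> 'a. local_frame \<Omega> T z \<gamma>)
      in frame_operator \<gamma> z (curvature_matrix \<gamma> z))"

definition curvature_dbar ::
  "'n::finite itself \<Rightarrow> complex set \<Rightarrow> ('a::chilbert_space \<Rightarrow> 'a) \<Rightarrow> complex \<Rightarrow> 'a \<Rightarrow> 'a" where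
  "curvature_dbar N \<Omega> T z =
     (let \<gamma> = (SOME \<gamma> :: 'n \<Rightarrow> complex \<Rightarrow> 'a. local_frame \<Omega> T z \<gamma>)
      in frame_operator \<gamma> z (matrix_dbar (curvature_matrix \<gamma>) z))"

end

theory Submission
  imports Defs
begin

text \<open>
  Let \<open>\<phi>\<close> be the Moebius transformation with \<open>\<phi> 0 = z\<close>. Homogeneity gives a unitary \<open>V\<close> with
  \<open>V \<phi>(T) = T V\<close>, which therefore maps \<open>ker (T - w)\<close> onto \<open>ker (T - \<phi> w)\<close>. For frames \<open>\<gamma>\<close> near \<open>0\<close> and
  \<open>\<delta>\<close> near \<open>z\<close> this reads \<open>V (\<gamma> w) = \<delta> (\<phi> w) a(w)\<close> with a holomorphic matrix \<open>a\<close>, so the Gram matrices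
  satisfy \<open>h = a\<^sup>* (k \<circ> \<phi>) a\<close>. Differentiating, \<open>V\<close> carries the curvature \<open>K\<close> and its covariant derivative
  \<open>L\<close> at \<open>0\<close> to \<open>p K\<close> and \<open>q L + r K\<close> at \<open>z\<close>, where \<open>p, q \<noteq> 0\<close> and \<open>r\<close> depend only on \<open>\<phi>\<close>. As the
  constants are the same for both operators, an equivalence at \<open>0\<close> is transported to one at \<open>z\<close>.
  A holomorphic frame near \<open>z\<close> is obtained from power series \<open>\<Sum>k. (w - z)\<^sup>k x\<^sub>k\<close> with \<open>(T - z) x\<^sub>0 = 0\<close> and
  \<open>(T - z) x\<^sub>k\<^sub>+\<^sub>1 = x\<^sub>k\<close>, whose coefficients grow at most geometrically by the open mapping theorem.
\<close>

section \<open>Wirtinger calculus for matrices\<close>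

definition has_wirtinger :: "(complex \<Rightarrow> complex) \<Rightarrow> complex \<Rightarrow> complex \<Rightarrow> complex \<Rightarrow> bool" where
  "has_wirtinger f p q z \<longleftrightarrow> (f has_derivative (\<lambda>h. h * p + cnj h * q)) (at z)"

lemma has_wirtinger_imp:
  assumes "has_wirtinger f p q z"
  shows "wirtinger_d f z = p" "wirtinger_dbar f z = q" "f differentiable at z"
proof -
  have "frechet_derivative f (at z) = (\<lambda>h. h * p + cnj h * q)"
    using assms unfolding has_wirtinger_def by (metis frechet_derivative_at)
  then show "wirtinger_d f z = p" "wirtinger_dbar f z = q"
    by (simp_all add: wirtinger_d_def wirtinger_dbar_def algebra_simps)
  show "f differentiable at z"
    using assms unfolding has_wirtinger_def differentiable_def by blast
qed

lemma differentiable_imp_has_wirtinger: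
  assumes "f differentiable at z"
  shows "has_wirtinger f (wirtinger_d f z) (wirtinger_dbar f z) z"
proof -
  define F where "F = frechet_derivative f (at z)"
  have D: "(f has_derivative F) (at z)"
    using assms unfolding F_def by (simp add: frechet_derivative_works)
  have F: "F h = h * wirtinger_d f z + cnj h * wirtinger_dbar f z" for h
  proof -
    have "F h = F (Re h *\<^sub>R 1 + Im h *\<^sub>R \<i>)"
      by (rule arg_cong[of _ _ F]) (simp add: complex_eq_iff)
    also have "\<dots> = Re h *\<^sub>R F 1 + Im h *\<^sub>R F \<i>"
      using has_derivative_linear[OF D] by (simp only: linear_add linear_scale)
    also have "\<dots> = h * wirtinger_d f z + cnj h * wirtinger_dbar f z"
      unfolding wirtinger_d_def wirtinger_dbar_def F_def[symmetric]
      by (simp add: complex_eq_iff field_simps)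
    finally show ?thesis .
  qed
  show ?thesis
    using D unfolding has_wirtinger_def by (simp add: F[abs_def])
qed

lemma has_wirtinger_mult:
  assumes "has_wirtinger f p q z" "has_wirtinger g r s z"
  shows "has_wirtinger (\<lambda>w. f w * g w) (p * g z + f z * r) (q * g z + f z * s) z"
  using has_derivative_mult[OF assms[unfolded has_wirtinger_def]]
  unfolding has_wirtinger_def by (simp add: algebra_simps)

lemma has_wirtinger_sum:
  assumes "\<And>i. i \<in> I \<Longrightarrow> has_wirtinger (f i) (p i) (q i) z"
  shows "has_wirtinger (\<lambda>w. \<Sum>i\<in>I. f i w) (\<Sum>i\<in>I. p i) (\<Sum>i\<in>I. q i) z"
  using has_derivative_sum[of I f "\<lambda>i h. h * p i + cnj h * q i" "at z"] assms
  unfolding has_wirtinger_def by (simp add: sum_distrib_left sum.distrib)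

lemma has_wirtinger_add:
  assumes "has_wirtinger f p q z" "has_wirtinger g r s z"
  shows "has_wirtinger (\<lambda>w. f w + g w) (p + r) (q + s) z"
  using has_derivative_add[OF assms[unfolded has_wirtinger_def]]
  unfolding has_wirtinger_def by (simp add: algebra_simps)

lemma has_wirtinger_holomorphic:
  assumes "(f has_field_derivative d) (at z)"
  shows "has_wirtinger f d 0 z"
  using assms unfolding has_wirtinger_def has_field_derivative_def
  by (simp add: mult.commute[of _ d] mult_commute_abs)

lemma has_wirtinger_cnj:
  assumes "has_wirtinger f p q z"
  shows "has_wirtinger (\<lambda>w. cnj (f w)) (cnj q) (cnj p) z"
  using has_derivative_cnj[OF assms[unfolded has_wirtinger_def]]
  unfolding has_wirtinger_def by (simp add: algebra_simps)

lemma has_wirtinger_compose: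
  assumes "has_wirtinger f p q (\<phi> z)" "(\<phi> has_field_derivative d) (at z)"
  shows "has_wirtinger (\<lambda>w. f (\<phi> w)) (p * d) (q * cnj d) z"
  using has_derivative_compose[OF assms(2)[unfolded has_field_derivative_def] assms(1)[unfolded has_wirtinger_def]]
  unfolding has_wirtinger_def by (simp add: algebra_simps)

lemma has_wirtinger_transform:
  assumes "has_wirtinger f p q z" "open U" "z \<in> U" "\<And>w. w \<in> U \<Longrightarrow> f w = g w"
  shows "has_wirtinger g p q z"
  using has_derivative_transform_within_open[OF assms(1)[unfolded has_wirtinger_def] assms(2-4)]
  unfolding has_wirtinger_def by simp

definition mat_has_wirtinger ::
  "(complex \<Rightarrow> complex^'n^'n) \<Rightarrow> complex^'n^'n \<Rightarrow> complex^'n^'n \<Rightarrow> complex \<Rightarrow> bool" where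
  "mat_has_wirtinger A P Q z \<longleftrightarrow>
     (\<forall>i j. has_wirtinger (\<lambda>w. A w $ i $ j) (P $ i $ j) (Q $ i $ j) z)"

lemma mat_has_wirtinger_imp:
  assumes "mat_has_wirtinger A P Q z"
  shows "matrix_d A z = P" "matrix_dbar A z = Q"
  using assms by (auto simp: mat_has_wirtinger_def matrix_d_def matrix_dbar_def vec_eq_iff
      intro: has_wirtinger_imp)

lemma mat_has_wirtinger_unique:
  assumes "mat_has_wirtinger A P Q z" "mat_has_wirtinger A P' Q' z"
  shows "P = P'" "Q = Q'"
  using assms mat_has_wirtinger_imp by blast+

lemma mat_differentiable_imp_has_wirtinger:
  fixes A :: "complex \<Rightarrow> complex^'n^'n"
  assumes "\<And>i j. (\<lambda>w. A w $ i $ j) differentiable at z"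
  shows "mat_has_wirtinger A (matrix_d A z) (matrix_dbar A z) z"
  using assms by (simp add: mat_has_wirtinger_def matrix_d_def matrix_dbar_def
      differentiable_imp_has_wirtinger)

lemma mat_has_wirtinger_mult:
  assumes "mat_has_wirtinger A P Q z" "mat_has_wirtinger B R S z"
  shows "mat_has_wirtinger (\<lambda>w. A w ** B w) (P ** B z + A z ** R) (Q ** B z + A z ** S) z"
  using assms unfolding mat_has_wirtinger_def matrix_matrix_mult_def
  by (auto simp flip: sum.distrib intro!: has_wirtinger_sum has_wirtinger_mult)

lemma mat_has_wirtinger_add:
  assumes "mat_has_wirtinger A P Q z" "mat_has_wirtinger B R S z"
  shows "mat_has_wirtinger (\<lambda>w. A w + B w) (P + R) (Q + S) z"
  using assms unfolding mat_has_wirtinger_def by (auto intro!: has_wirtinger_add)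

lemma mat_has_wirtinger_compose:
  assumes "mat_has_wirtinger A P Q (\<phi> z)" "(\<phi> has_field_derivative d) (at z)"
  shows "mat_has_wirtinger (\<lambda>w. A (\<phi> w)) (P ** mat d) (Q ** mat (cnj d)) z"
  using assms unfolding mat_has_wirtinger_def
  by (auto simp: matrix_matrix_mult_def mat_def if_distrib[of "\<lambda>x. _ * x"] cong: if_cong
      intro!: has_wirtinger_compose[where \<phi> = \<phi>])

lemma mat_has_wirtinger_transform:
  assumes "mat_has_wirtinger A P Q z" "open U" "z \<in> U" "\<And>w. w \<in> U \<Longrightarrow> A w = B w"
  shows "mat_has_wirtinger B P Q z"
  unfolding mat_has_wirtinger_def
proof (intro allI)
  fix i j
  show "has_wirtinger (\<lambda>w. B w $ i $ j) (P $ i $ j) (Q $ i $ j) z"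
    by (rule has_wirtinger_transform[of "\<lambda>w. A w $ i $ j", OF _ assms(2,3)])
       (use assms in \<open>auto simp: mat_has_wirtinger_def\<close>)
qed

lemma has_wirtinger_const: "has_wirtinger (\<lambda>w. c) 0 0 z"
  unfolding has_wirtinger_def by simp

lemma mat_has_wirtinger_const: "mat_has_wirtinger (\<lambda>w. C) 0 0 z"
  unfolding mat_has_wirtinger_def by (simp add: has_wirtinger_const)

lemma mat_has_wirtinger_scalar:
  assumes "has_wirtinger f p q z"
  shows "mat_has_wirtinger (\<lambda>w. mat (f w)) (mat p) (mat q) z"
  using assms unfolding mat_has_wirtinger_def mat_def by (simp add: has_wirtinger_const)

lemma differentiable_prod:
  fixes f :: "'i \<Rightarrow> complex \<Rightarrow> complex"
  assumes "\<And>i. i \<in> I \<Longrightarrow> f i differentiable at z"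
  shows "(\<lambda>w. \<Prod>i\<in>I. f i w) differentiable at z"
proof -
  have "\<exists>D. \<forall>i\<in>I. (f i has_derivative D i) (at z)"
    using assms unfolding differentiable_def by (auto intro!: bchoice)
  then show ?thesis
    unfolding differentiable_def by (blast intro: has_derivative_prod)
qed

lemma differentiable_det:
  fixes A :: "complex \<Rightarrow> complex^'n^'n"
  assumes "\<And>i j. (\<lambda>w. A w $ i $ j) differentiable at z"
  shows "(\<lambda>w. det (A w)) differentiable at z"
  unfolding det_def using assms
  by (intro differentiable_sum ballI differentiable_mult differentiable_prod) simp_all

lemma holomorphic_on_det:
  fixes A :: "complex \<Rightarrow> complex^'n^'n"
  assumes "\<And>i j. (\<lambda>w. A w $ i $ j) holomorphic_on U"
  shows "(\<lambda>w. det (A w)) holomorphic_on U"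
  unfolding det_def by (intro holomorphic_intros assms)

lemma matrix_inv_left_right:
  fixes A :: "complex^'n^'n"
  assumes "det A \<noteq> 0"
  shows "matrix_inv A ** A = mat 1" "A ** matrix_inv A = mat 1"
proof -
  have "\<exists>A'. A ** A' = mat 1 \<and> A' ** A = mat 1"
    using assms by (simp add: invertible_det_nz[symmetric] invertible_def)
  from someI_ex[OF this] show "matrix_inv A ** A = mat 1" "A ** matrix_inv A = mat 1"
    by (auto simp: matrix_inv_def)
qed

lemma matrix_inv_unique_left:
  fixes A :: "complex^'n^'n"
  assumes "B ** A = mat 1"
  shows "matrix_inv A = B" "det A \<noteq> 0"
proof -
  show d: "det A \<noteq> 0" using assms
    by (metis invertible_det_nz invertible_left_inverse)
  have "B ** (A ** matrix_inv A) = matrix_inv A"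
    by (simp add: matrix_mul_assoc assms)
  then show "matrix_inv A = B" by (simp add: matrix_inv_left_right[OF d])
qed

lemma matrix_inv_cramer:
  fixes A :: "complex^'n^'n"
  assumes "det A \<noteq> 0"
  shows "matrix_inv A $ k $ l =
    det (\<chi> i j. if j = k then mat 1 $ i $ l else A $ i $ j) / det A"
proof -
  have "A *v (column l (matrix_inv A)) = column l (mat 1)"
    using matrix_inv_left_right(2)[OF assms]
    by (auto simp: vec_eq_iff matrix_matrix_mult_def matrix_vector_mult_def column_def)
  then have "column l (matrix_inv A) = (\<chi> k. det (\<chi> i j. if j = k then column l (mat 1) $ i else A $ i $ j) / det A)"
    using cramer[OF assms] by blast
  then have "column l (matrix_inv A) $ k = (\<chi> k. det (\<chi> i j. if j = k then column l (mat 1) $ i else A $ i $ j) / det A) $ k"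
    by (rule arg_cong)
  then show ?thesis by (simp add: column_def cong: if_cong)
qed

lemma differentiable_matrix_inv:
  fixes A :: "complex \<Rightarrow> complex^'n^'n"
  assumes A: "\<And>i j. (\<lambda>w. A w $ i $ j) differentiable at z"
    and U: "open U" "z \<in> U" "\<And>w. w \<in> U \<Longrightarrow> det (A w) \<noteq> 0"
  shows "(\<lambda>w. matrix_inv (A w) $ k $ l) differentiable at z"
proof -
  have B: "(\<lambda>w. (\<chi> i j. if j = k then mat 1 $ i $ l else A w $ i $ j) $ i $ j) differentiable at z" for i j
    using A by (cases "j = k") simp_all
  have "(\<lambda>w. det (\<chi> i j. if j = k then mat 1 $ i $ l else A w $ i $ j) / det (A w)) differentiable at z"
    by (intro differentiable_divide differentiable_det A B U(3)[OF U(2)])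
  then obtain D where "((\<lambda>w. det (\<chi> i j. if j = k then mat 1 $ i $ l else A w $ i $ j) / det (A w)) has_derivative D) (at z)"
    unfolding differentiable_def by blast
  then have "((\<lambda>w. matrix_inv (A w) $ k $ l) has_derivative D) (at z)"
    by (rule has_derivative_transform_within_open[OF _ U(1,2)]) (simp add: matrix_inv_cramer U)
  then show ?thesis unfolding differentiable_def by blast
qed

lemma holomorphic_on_matrix_inv:
  fixes A :: "complex \<Rightarrow> complex^'n^'n"
  assumes A: "\<And>i j. (\<lambda>w. A w $ i $ j) holomorphic_on U"
    and U: "\<And>w. w \<in> U \<Longrightarrow> det (A w) \<noteq> 0"
  shows "(\<lambda>w. matrix_inv (A w) $ k $ l) holomorphic_on U"
proof -
  have B: "(\<lambda>w. (\<chi> i j. if j = k then mat 1 $ i $ l else A w $ i $ j) $ i $ j) holomorphic_on U" for i j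
    using A by (cases "j = k") simp_all
  have "(\<lambda>w. det (\<chi> i j. if j = k then mat 1 $ i $ l else A w $ i $ j) / det (A w)) holomorphic_on U"
    by (intro holomorphic_intros holomorphic_on_det A B U)
  then show ?thesis
    by (rule holomorphic_transform) (simp add: matrix_inv_cramer U)
qed

lemma matrix_mul_add_rdistrib: "((B::'a::semiring_1^'n^'m) + C) ** A = B ** A + C ** A"
  by (simp add: matrix_matrix_mult_def vec_eq_iff sum.distrib distrib_right)

lemma mat_has_wirtinger_inv:
  assumes A: "mat_has_wirtinger A P Q z"
    and U: "open U" "z \<in> U" "\<And>w. w \<in> U \<Longrightarrow> det (A w) \<noteq> 0"
  shows "mat_has_wirtinger (\<lambda>w. matrix_inv (A w))
     (- (matrix_inv (A z) ** P ** matrix_inv (A z))) (- (matrix_inv (A z) ** Q ** matrix_inv (A z))) z"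
proof -
  let ?B = "\<lambda>w. matrix_inv (A w)"
  have "(\<lambda>w. A w $ i $ j) differentiable at z" for i j
    using A unfolding mat_has_wirtinger_def by (blast intro: has_wirtinger_imp)
  then have B: "mat_has_wirtinger ?B (matrix_d ?B z) (matrix_dbar ?B z) z"
    by (intro mat_differentiable_imp_has_wirtinger differentiable_matrix_inv[OF _ U])
  have "mat_has_wirtinger (\<lambda>w. ?B w ** A w) 0 0 z"
    by (rule mat_has_wirtinger_transform[OF mat_has_wirtinger_const[of "mat 1"] U(1,2)])
       (simp add: matrix_inv_left_right U)
  from mat_has_wirtinger_unique[OF mat_has_wirtinger_mult[OF B A] this]
  have *: "matrix_d ?B z ** A z + ?B z ** P = 0" "matrix_dbar ?B z ** A z + ?B z ** Q = 0" .
  have **: "X = - (?B z ** Y ** ?B z)" if "X ** A z + ?B z ** Y = 0" for X Y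
  proof -
    have "(X ** A z + ?B z ** Y) ** ?B z = 0"
      unfolding that by (simp add: matrix_matrix_mult_def vec_eq_iff)
    then have "X + ?B z ** Y ** ?B z = 0"
      by (simp add: matrix_mul_add_rdistrib matrix_mul_assoc[symmetric] matrix_inv_left_right U)
    then show ?thesis by (simp add: eq_neg_iff_add_eq_0)
  qed
  show ?thesis using B **[OF *(1)] **[OF *(2)] by simp
qed

lemma matrix_mul_zero [simp]:
  "(0::'a::semiring_1^'n^'m) ** A = 0" "B ** (0::'a^'n^'m) = 0"
  by (simp_all add: matrix_matrix_mult_def vec_eq_iff)

lemma mat_mul_mat: "mat c ** mat d = (mat (c * d) :: 'a::semiring_1^'n^'n)"
  by (simp add: vec_eq_iff matrix_matrix_mult_def mat_def if_distrib[of "\<lambda>x. _ * x"]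
     if_distrib[of "\<lambda>x. x * _"] cong: if_cong)

definition adjoint_matrix :: "complex^'n^'n \<Rightarrow> complex^'n^'n" where
  "adjoint_matrix A = (\<chi> i j. cnj (A $ j $ i))"

lemma adjoint_matrix_mult: "adjoint_matrix (A ** B) = adjoint_matrix B ** adjoint_matrix A"
  by (simp add: adjoint_matrix_def matrix_matrix_mult_def vec_eq_iff mult.commute)

lemma adjoint_matrix_mat: "adjoint_matrix (mat c) = mat (cnj c)"
  by (simp add: adjoint_matrix_def mat_def vec_eq_iff)

definition mat_deriv :: "(complex \<Rightarrow> complex^'n^'n) \<Rightarrow> complex \<Rightarrow> complex^'n^'n" where
  "mat_deriv A z = (\<chi> i j. deriv (\<lambda>w. A w $ i $ j) z)"

lemma mat_has_wirtinger_holomorphic: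
  fixes A :: "complex \<Rightarrow> complex^'n^'n"
  assumes "\<And>i j. (\<lambda>w. A w $ i $ j) holomorphic_on U" "open U" "z \<in> U"
  shows "mat_has_wirtinger A (mat_deriv A z) 0 z"
  using assms unfolding mat_has_wirtinger_def mat_deriv_def
  by (auto intro!: has_wirtinger_holomorphic holomorphic_derivI)

lemma mat_has_wirtinger_adjoint:
  assumes "mat_has_wirtinger A P Q z"
  shows "mat_has_wirtinger (\<lambda>w. adjoint_matrix (A w)) (adjoint_matrix Q) (adjoint_matrix P) z"
  using assms unfolding mat_has_wirtinger_def adjoint_matrix_def
  by (simp add: has_wirtinger_cnj)

definition mat_wirtinger_differentiable :: "(complex \<Rightarrow> complex^'n^'n) \<Rightarrow> complex \<Rightarrow> bool" where
  "mat_wirtinger_differentiable A z \<longleftrightarrow> mat_has_wirtinger A (matrix_d A z) (matrix_dbar A z) z"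

lemma mat_wirtinger_differentiableI:
  assumes "mat_has_wirtinger A P Q z"
  shows "mat_wirtinger_differentiable A z"
  using assms mat_has_wirtinger_imp[OF assms] unfolding mat_wirtinger_differentiable_def by simp

definition metric_curvature :: "(complex \<Rightarrow> complex^'n^'n) \<Rightarrow> complex \<Rightarrow> complex^'n^'n" where
  "metric_curvature h = matrix_dbar (\<lambda>w. matrix_inv (h w) ** matrix_d h w)"

text \<open>\<^const>\<open>frechet_derivative\<close> is unspecified at points where the function is not
  differentiable, so every derivative that is taken needs such a hypothesis.\<close>

definition regular_metric_on :: "(complex \<Rightarrow> complex^'n^'n) \<Rightarrow> complex set \<Rightarrow> bool" where
  "regular_metric_on h V \<longleftrightarrow> open V \<and> (\<forall>v\<in>V. det (h v) \<noteq> 0 \<and>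
     mat_wirtinger_differentiable h v \<and> mat_wirtinger_differentiable (matrix_d h) v \<and>
     mat_wirtinger_differentiable (metric_curvature h) v)"

lemma regular_metric_on_connection:
  assumes "regular_metric_on h V" "v \<in> V"
  obtains P where
    "mat_has_wirtinger (\<lambda>w. matrix_inv (h w) ** matrix_d h w) P (metric_curvature h v) v"
proof -
  from assms have
    "mat_has_wirtinger (\<lambda>w. matrix_inv (h w))
     (- (matrix_inv (h v) ** matrix_d h v ** matrix_inv (h v)))
     (- (matrix_inv (h v) ** matrix_dbar h v ** matrix_inv (h v))) v"
    unfolding regular_metric_on_def mat_wirtinger_differentiable_def
    by (intro mat_has_wirtinger_inv[where U = V]) auto
  moreover from assms have
    "mat_has_wirtinger (matrix_d h) (matrix_d (matrix_d h) v) (matrix_dbar (matrix_d h) v) v"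
    unfolding regular_metric_on_def mat_wirtinger_differentiable_def by auto
  ultimately have D: "mat_has_wirtinger (\<lambda>w. matrix_inv (h w) ** matrix_d h w)
      (- (matrix_inv (h v) ** matrix_d h v ** matrix_inv (h v)) ** matrix_d h v + matrix_inv (h v) ** matrix_d (matrix_d h) v)
      (- (matrix_inv (h v) ** matrix_dbar h v ** matrix_inv (h v)) ** matrix_d h v + matrix_inv (h v) ** matrix_dbar (matrix_d h) v) v"
    by (rule mat_has_wirtinger_mult)
  show ?thesis
    using that D mat_has_wirtinger_imp(2)[OF D] unfolding metric_curvature_def by simp
qed

text \<open>Scalar multiples of matrices are written as products with \<^term>\<open>mat c\<close>, so that the
  product rule for matrices covers them.\<close>

lemma metric_curvature_pullback:
  fixes h k a :: "complex \<Rightarrow> complex^'n^'n"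
  assumes k: "regular_metric_on k V" and U: "open U"
    and phi: "\<phi> holomorphic_on U" "\<phi> ` U \<subseteq> V"
    and a: "\<And>i j. (\<lambda>w. a w $ i $ j) holomorphic_on U" "\<And>w. w \<in> U \<Longrightarrow> det (a w) \<noteq> 0"
    and h: "\<And>w. w \<in> U \<Longrightarrow> h w = adjoint_matrix (a w) ** k (\<phi> w) ** a w"
    and w: "w \<in> U"
  shows "a w ** metric_curvature h w =
      metric_curvature k (\<phi> w) ** mat (cnj (deriv \<phi> w) * deriv \<phi> w) ** a w" (is ?A)
    and "a w ** matrix_dbar (metric_curvature h) w =
      (matrix_dbar (metric_curvature k) (\<phi> w) ** mat ((cnj (deriv \<phi> w))\<^sup>2 * deriv \<phi> w) +
       metric_curvature k (\<phi> w) ** mat (cnj (deriv (deriv \<phi>) w) * deriv \<phi> w)) ** a w" (is ?B)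
proof -
  let ?b = "\<lambda>w. matrix_inv (a w)"
  let ?G = "\<lambda>w. matrix_inv (k w) ** matrix_d k w"
  have phi': "(\<phi> has_field_derivative deriv \<phi> w) (at w)" if "w \<in> U" for w
    by (rule holomorphic_derivI[OF phi(1) U that])
  have phi'': "(deriv \<phi> has_field_derivative deriv (deriv \<phi>) w) (at w)" if "w \<in> U" for w
    by (rule holomorphic_derivI[OF holomorphic_deriv[OF phi(1) U] U that])
  have Da: "mat_has_wirtinger a (mat_deriv a w) 0 w" if "w \<in> U" for w
    by (rule mat_has_wirtinger_holomorphic[OF a(1) U that])
  have Dadj: "mat_has_wirtinger (\<lambda>w. adjoint_matrix (a w)) 0 (adjoint_matrix (mat_deriv a w)) w"
    if "w \<in> U" for w
    using mat_has_wirtinger_adjoint[OF Da[OF that]]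
    by (simp add: adjoint_matrix_def zero_vec_def)
  have Da': "mat_has_wirtinger (mat_deriv a) (mat_deriv (mat_deriv a) w) 0 w" if "w \<in> U" for w
    by (rule mat_has_wirtinger_holomorphic[OF _ U that])
       (simp add: mat_deriv_def holomorphic_deriv[OF a(1) U])
  have Db: "mat_has_wirtinger ?b (- (?b w ** mat_deriv a w ** ?b w)) 0 w" if "w \<in> U" for w
    using mat_has_wirtinger_inv[OF Da[OF that] U that a(2)] by simp
  have inv_a: "?b w ** a w = mat 1" "a w ** ?b w = mat 1" if "w \<in> U" for w
    using matrix_inv_left_right a(2) that by blast+
  have kV: "det (k (\<phi> w)) \<noteq> 0" "mat_wirtinger_differentiable k (\<phi> w)"
    "mat_wirtinger_differentiable (metric_curvature k) (\<phi> w)" if "w \<in> U" for w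
    using k phi(2) that unfolding regular_metric_on_def by blast+
  have dh: "matrix_d h w = adjoint_matrix (a w) ** matrix_d k (\<phi> w) ** mat (deriv \<phi> w) ** a w
     + adjoint_matrix (a w) ** k (\<phi> w) ** mat_deriv a w" if "w \<in> U" for w
  proof -
    note 1 = mat_has_wirtinger_compose[OF kV(2)[OF that, unfolded mat_wirtinger_differentiable_def]
        phi'[OF that]]
    note 2 = mat_has_wirtinger_mult[OF mat_has_wirtinger_mult[OF Dadj[OF that] 1] Da[OF that]]
    note 3 = mat_has_wirtinger_transform[OF 2 U that h[symmetric]]
    show ?thesis using mat_has_wirtinger_imp(1)[OF 3] by (simp add: matrix_mul_assoc)
  qed
  have inv_h: "matrix_inv (h w) = ?b w ** matrix_inv (k (\<phi> w)) ** adjoint_matrix (?b w)"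
    if "w \<in> U" for w
  proof (rule matrix_inv_unique_left)
    have adj: "adjoint_matrix (?b w) ** adjoint_matrix (a w) = mat 1"
      by (simp add: inv_a that adjoint_matrix_mat flip: adjoint_matrix_mult)
    have "?b w ** matrix_inv (k (\<phi> w)) ** adjoint_matrix (?b w) ** h w
      = ?b w ** (matrix_inv (k (\<phi> w)) ** (adjoint_matrix (?b w) ** adjoint_matrix (a w)) ** k (\<phi> w)) ** a w"
      by (simp add: h[OF that] matrix_mul_assoc)
    then show "?b w ** matrix_inv (k (\<phi> w)) ** adjoint_matrix (?b w) ** h w = mat 1"
      by (simp add: adj matrix_inv_left_right(1)[OF kV(1)[OF that]] inv_a that)
  qed
  have conn: "matrix_inv (h w) ** matrix_d h w =
     ?b w ** (?G (\<phi> w) ** mat (deriv \<phi> w)) ** a w + ?b w ** mat_deriv a w" if "w \<in> U" for w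
  proof -
    have adj: "adjoint_matrix (?b w) ** adjoint_matrix (a w) = mat 1"
      by (simp add: inv_a that adjoint_matrix_mat flip: adjoint_matrix_mult)
    have "matrix_inv (h w) ** matrix_d h w =
      ?b w ** matrix_inv (k (\<phi> w)) ** (adjoint_matrix (?b w) ** adjoint_matrix (a w)) **
        matrix_d k (\<phi> w) ** mat (deriv \<phi> w) ** a w +
      ?b w ** (matrix_inv (k (\<phi> w)) ** (adjoint_matrix (?b w) ** adjoint_matrix (a w)) ** k (\<phi> w)) **
         mat_deriv a w"
      by (simp add: inv_h dh that matrix_add_ldistrib matrix_mul_assoc)
    then show ?thesis
      by (simp add: adj matrix_inv_left_right(1)[OF kV(1)[OF that]] matrix_mul_assoc)
  qed
  have curv: "metric_curvature h w =
      ?b w ** (metric_curvature k (\<phi> w) ** mat (cnj (deriv \<phi> w)) ** mat (deriv \<phi> w)) ** a w"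
    if "w \<in> U" for w
  proof -
    have "\<phi> w \<in> V" using phi(2) that by blast
    then obtain P where P: "mat_has_wirtinger ?G P (metric_curvature k (\<phi> w)) (\<phi> w)"
      using regular_metric_on_connection[OF k] by blast
    note 1 = mat_has_wirtinger_compose[OF P phi'[OF that]]
    note 2 = mat_has_wirtinger_scalar[OF has_wirtinger_holomorphic[OF phi''[OF that]]]
    note 3 = mat_has_wirtinger_mult[OF mat_has_wirtinger_mult[OF Db[OF that]
          mat_has_wirtinger_mult[OF 1 2]] Da[OF that]]
    note 4 = mat_has_wirtinger_add[OF 3 mat_has_wirtinger_mult[OF Db[OF that] Da'[OF that]]]
    note 5 = mat_has_wirtinger_transform[OF 4 U that conn[symmetric]]
    show ?thesis using mat_has_wirtinger_imp(2)[OF 5]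
      by (simp add: metric_curvature_def mat_0)
  qed
  have canc: "a w ** (?b w ** X ** Y) = X ** Y" for X Y
    by (simp add: matrix_mul_assoc inv_a w)
  show ?A
    by (simp add: curv w canc matrix_mul_assoc[symmetric] mat_mul_mat)
       (simp add: matrix_mul_assoc inv_a w)
  note 1 = mat_has_wirtinger_compose[OF kV(3)[OF w, unfolded mat_wirtinger_differentiable_def]
      phi'[OF w]]
  note 2 = mat_has_wirtinger_scalar[OF has_wirtinger_holomorphic[OF phi''[OF w]]]
  note 3 = mat_has_wirtinger_scalar[OF has_wirtinger_cnj[OF has_wirtinger_holomorphic[OF phi''[OF w]]]]
  note 4 = mat_has_wirtinger_mult[OF mat_has_wirtinger_mult[OF Db[OF w]
      mat_has_wirtinger_mult[OF mat_has_wirtinger_mult[OF 1 3] 2]] Da[OF w]]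
  note 5 = mat_has_wirtinger_transform[OF 4 U w curv[symmetric]]
  have *: "matrix_dbar (metric_curvature h) w =
    ?b w ** ((matrix_dbar (metric_curvature k) (\<phi> w) ** mat (cnj (deriv \<phi> w)) ** mat (cnj (deriv \<phi> w)) +
       metric_curvature k (\<phi> w) ** mat (cnj (deriv (deriv \<phi>) w))) ** mat (deriv \<phi> w)) ** a w"
    using mat_has_wirtinger_imp(2)[OF 5] by (simp add: mat_0)
  show ?B unfolding * canc
    by (simp add: matrix_mul_add_rdistrib mat_mul_mat power2_eq_square flip: matrix_mul_assoc)
qed

section \<open>Inner products and finite families of vectors\<close>

subclass (in chilbert_space) banach ..

lemma cinner_add_right: "cinner x (y + z) = cinner x y + cinner x (z::'a::chilbert_space)"
  by (metis cinner_add_left cinner_commute complex_cnj_add)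

lemma cinner_scaleC_right: "cinner x (c *\<^sub>C y) = cnj c * cinner x (y::'a::chilbert_space)"
  by (metis cinner_commute cinner_scaleC_left complex_cnj_mult)

lemma scaleC_0 [simp]: "0 *\<^sub>C x = (0::'a::chilbert_space)" "c *\<^sub>C 0 = (0::'a)"
  by (simp_all add: complex_vector.scale_zero_left complex_vector.scale_zero_right)

lemma cinner_zero [simp]: "cinner 0 x = 0" "cinner x (0::'a::chilbert_space) = 0"
  by (metis cinner_scaleC_left mult_zero_left scaleC_0(1),
      metis cinner_scaleC_right complex_cnj_zero mult_zero_left scaleC_0(1))

lemma cinner_sum_left: "cinner (\<Sum>i\<in>I. f i) y = (\<Sum>i\<in>I. cinner (f i) (y::'a::chilbert_space))"
  by (induction I rule: infinite_finite_induct) (auto simp: cinner_add_left)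

lemma cinner_sum_right: "cinner y (\<Sum>i\<in>I. f i) = (\<Sum>i\<in>I. cinner y (f i ::'a::chilbert_space))"
  by (induction I rule: infinite_finite_induct) (auto simp: cinner_add_right)

lemma cinner_self: "cinner x x = complex_of_real ((norm (x::'a::chilbert_space))\<^sup>2)"
proof -
  have "Im (cinner x x) = 0"
    using cinner_commute[of x x] by (metis Reals_cnj_iff complex_is_Real_iff)
  then show ?thesis
    by (simp add: complex_eq_iff Re_cinner power2_norm_eq_inner)
qed

lemma norm_scaleC: "norm (c *\<^sub>C x) = cmod c * norm (x::'a::chilbert_space)"
proof -
  have "complex_of_real ((norm (c *\<^sub>C x))\<^sup>2) = c * cnj c * complex_of_real ((norm x)\<^sup>2)"
    unfolding cinner_self[symmetric] by (simp add: cinner_scaleC_left cinner_scaleC_right)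
  also have "\<dots> = complex_of_real ((cmod c * norm x)\<^sup>2)"
    by (simp add: complex_norm_square[symmetric] power_mult_distrib)
  finally have "(norm (c *\<^sub>C x))\<^sup>2 = (cmod c * norm x)\<^sup>2"
    using of_real_eq_iff by blast
  then show ?thesis by simp
qed

lemma norm_cinner: "cmod (cinner x y) \<le> norm x * norm (y::'a::chilbert_space)"
proof -
  define u where "u = cnj (sgn (cinner x y))"
  have "complex_of_real (cmod (cinner x y)) = u * cinner x y"
  proof (cases "cinner x y = 0")
    case False
    have "u * cinner x y = complex_of_real ((cmod (cinner x y))\<^sup>2) / cmod (cinner x y)"
      unfolding u_def sgn_eq complex_norm_square by simp
    then show ?thesis using False by (simp add: power2_eq_square)
  qed simp
  then have "cmod (cinner x y) = Re (cinner (u *\<^sub>C x) y)"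
    by (metis Re_complex_of_real cinner_scaleC_left)
  also have "\<dots> \<le> norm (u *\<^sub>C x) * norm y"
    by (simp add: Re_cinner norm_cauchy_schwarz)
  also have "\<dots> \<le> 1 * norm x * norm y"
    unfolding norm_scaleC by (intro mult_right_mono) (auto simp: u_def norm_sgn)
  finally show ?thesis by simp
qed

lemma scaleR_scaleC: "r *\<^sub>R x = complex_of_real r *\<^sub>C (x::'a::chilbert_space)"
  by (simp add: scaleC_of_real)

lemma bounded_bilinear_cinner: "bounded_bilinear (cinner :: 'a::chilbert_space \<Rightarrow> 'a \<Rightarrow> complex)"
proof
  show "\<exists>K. \<forall>a b :: 'a. norm (cinner a b) \<le> norm a * norm b * K"
    by (rule exI[of _ 1]) (simp add: norm_cinner)
qed (auto simp: cinner_add_left cinner_add_right scaleR_scaleC cinner_scaleC_left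
    cinner_scaleC_right scaleR_conv_of_real)

lemma bounded_bilinear_scaleC: "bounded_bilinear (scaleC :: complex \<Rightarrow> 'a::chilbert_space \<Rightarrow> 'a)"
proof
  show "\<exists>K. \<forall>a (b::'a). norm (a *\<^sub>C b) \<le> norm a * norm b * K"
    by (rule exI[of _ 1]) (simp add: norm_scaleC)
qed (auto simp: scaleC_add_left scaleC_add_right scaleR_scaleC scaleC_scaleC scaleR_conv_of_real mult.commute)

lemma bounded_linear_scaleC_right: "bounded_linear (\<lambda>x. c *\<^sub>C (x::'a::chilbert_space))"
  using bounded_bilinear.bounded_linear_right[OF bounded_bilinear_scaleC] .

definition independent_family :: "('n::finite \<Rightarrow> 'a::chilbert_space) \<Rightarrow> bool" where
  "independent_family g \<longleftrightarrow> (\<forall>c. (\<Sum>j\<in>UNIV. c j *\<^sub>C g j) = 0 \<longrightarrow> (\<forall>j. c j = 0))"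

lemma independent_family_iff:
  "independent_family g \<longleftrightarrow> inj g \<and> complex_vector.independent (range g)"
proof
  assume g: "independent_family g"
  have inj: "inj g"
  proof (rule injI, rule ccontr)
    fix i j assume ij: "g i = g j" "i \<noteq> j"
    have "(\<Sum>k\<in>UNIV. (if k = i then 1 else if k = j then -1 else 0) *\<^sub>C g k)
      = (\<Sum>k\<in>{i,j}. (if k = i then 1 else if k = j then -1 else 0) *\<^sub>C g k)"
      by (rule sum.mono_neutral_right) auto
    also have "\<dots> = 0" using ij by (simp add: scaleC_one)
    finally show False
      using g[unfolded independent_family_def, rule_format, of "\<lambda>k. if k = i then 1 else if k = j then -1 else 0" i]
      by simp
  qed
  moreover have "complex_vector.independent (range g)"
  proof (rule complex_vector.independent_if_scalars_zero)
    fix f x assume "(\<Sum>x\<in>range g. f x *\<^sub>C x) = 0" and x: "x \<in> range g"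
    then have "(\<Sum>j\<in>UNIV. f (g j) *\<^sub>C g j) = 0"
      by (simp add: sum.reindex[OF inj])
    then have "f (g j) = 0" for j
      using g[unfolded independent_family_def, rule_format, of "\<lambda>j. f (g j)"] by blast
    then show "f x = 0" using x by blast
  qed simp
  ultimately show "inj g \<and> complex_vector.independent (range g)" ..
next
  assume g: "inj g \<and> complex_vector.independent (range g)"
  show "independent_family g"
    unfolding independent_family_def
  proof (intro allI impI)
    fix c j assume "(\<Sum>j\<in>UNIV. c j *\<^sub>C g j) = 0"
    then have "(\<Sum>x\<in>range g. c (inv g x) *\<^sub>C x) = 0"
      using g by (simp add: sum.reindex)
    then have "c (inv g (g j)) = 0"
      using complex_vector.independentD[of "range g" "range g" "\<lambda>x. c (inv g x)" "g j"] g by auto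
    then show "c j = 0" using g by simp
  qed
qed

lemma span_range_family:
  fixes g :: "'n::finite \<Rightarrow> 'a::chilbert_space"
  assumes "x \<in> complex_vector.span (range g)"
  obtains c where "x = (\<Sum>j\<in>UNIV. c j *\<^sub>C g j)"
  using assms
proof (induction arbitrary: thesis rule: complex_vector.span_induct_alt)
  case base
  show ?case by (rule base[of "\<lambda>_. 0"]) simp
next
  case (step c x y)
  obtain d where d: "y = (\<Sum>j\<in>UNIV. d j *\<^sub>C g j)" using step.IH by blast
  obtain i where i: "x = g i" using step.hyps by blast
  have "c *\<^sub>C x + y = (\<Sum>j\<in>UNIV. (if j = i then c else 0) *\<^sub>C g j) + y"
    by (simp add: i if_distrib[of "\<lambda>c. c *\<^sub>C _"] cong: if_cong)
  also have "\<dots> = (\<Sum>j\<in>UNIV. ((if j = i then c else 0) + d j) *\<^sub>C g j)"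
    by (simp add: d scaleC_add_left sum.distrib)
  finally show ?case by (rule step.prems)
qed

lemma sum_scaleC_in_span:
  "(\<Sum>j\<in>UNIV. c j *\<^sub>C g j) \<in> complex_vector.span (range (g :: 'n::finite \<Rightarrow> 'a::chilbert_space))"
  by (intro complex_vector.span_sum complex_vector.span_scale complex_vector.span_base) auto

lemma independent_family_spans:
  fixes g :: "'n::finite \<Rightarrow> 'a::chilbert_space"
  assumes g: "independent_family g" "\<And>i. g i \<in> E" and E: "complex_vector.subspace E"
    and dim: "complex_vector.dim E = CARD('n)"
  shows "complex_vector.span (range g) = E"
proof
  show "complex_vector.span (range g) \<subseteq> E"
    using g(2) E by (intro complex_vector.span_minimal) auto
  obtain B where B: "B \<subseteq> E" "complex_vector.independent B" "E \<subseteq> complex_vector.span B"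
    "card B = CARD('n)"
    using complex_vector.basis_exists dim by metis
  have "finite B" using B(4) by (metis card_gt_0_iff zero_less_card_finite)
  show "E \<subseteq> complex_vector.span (range g)"
  proof (rule ccontr)
    assume "\<not> ?thesis"
    then obtain x where x: "x \<in> E" "x \<notin> complex_vector.span (range g)" by blast
    have "complex_vector.independent (insert x (range g))"
      using g(1) x complex_vector.independent_insertI by (auto simp: independent_family_iff)
    moreover have "insert x (range g) \<subseteq> complex_vector.span B"
      using g(2) x(1) B(3) by blast
    ultimately have "card (insert x (range g)) \<le> card B"
      using complex_vector.independent_span_bound[OF \<open>finite B\<close>] by blast
    moreover have "x \<notin> range g"
      using x(2) complex_vector.span_base[of x "range g"] by blast
    moreover have "card (range g) = CARD('n)"
      using g(1) by (simp add: independent_family_iff card_image)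
    ultimately show False using B(4) by simp
  qed
qed

lemma exists_basis_family:
  fixes E :: "'a::chilbert_space set"
  assumes "complex_vector.dim E = CARD('n)"
  obtains g :: "'n::finite \<Rightarrow> 'a" where "independent_family g" "\<And>i. g i \<in> E"
proof -
  obtain B where B: "B \<subseteq> E" "complex_vector.independent B" "card B = CARD('n)"
    by (rule complex_vector.basis_exists[of E]) (simp add: assms)
  have "finite B" using B(3) by (metis card_gt_0_iff zero_less_card_finite)
  then obtain g :: "'n \<Rightarrow> 'a" where g: "bij_betw g UNIV B"
    using B(3) finite_same_card_bij[of "UNIV :: 'n set" B] finite_class.finite_UNIV by metis
  then have "independent_family g"
    using B(2) by (simp add: bij_betw_def independent_family_iff)
  moreover have "g i \<in> E" for i
    using g B(1) unfolding bij_betw_def by blast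
  ultimately show ?thesis by (rule that)
qed

definition cross_gram :: "('n::finite \<Rightarrow> 'a::chilbert_space) \<Rightarrow> ('n \<Rightarrow> 'a) \<Rightarrow> complex^'n^'n" where
  "cross_gram x y = (\<chi> l k. cinner (y k) (x l))"

lemma gram_eq_cross_gram: "gram \<gamma> w = cross_gram (\<lambda>i. \<gamma> i w) (\<lambda>i. \<gamma> i w)"
  by (simp add: gram_def cross_gram_def)

lemma cross_gram_mult_vector:
  "cross_gram x y *v c = (\<chi> l. cinner (\<Sum>k\<in>UNIV. c $ k *\<^sub>C y k) (x l))"
  by (simp add: cross_gram_def matrix_vector_mult_def cinner_sum_left cinner_scaleC_left mult.commute)

lemma det_nonzero_iff_ker:
  fixes A :: "complex^'n^'n"
  shows "det A \<noteq> 0 \<longleftrightarrow> (\<forall>x. A *v x = 0 \<longrightarrow> x = 0)"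
  by (metis invertible_det_nz invertible_left_inverse matrix_left_invertible_ker)

lemma det_cross_gram_self:
  assumes "independent_family x"
  shows "det (cross_gram x x) \<noteq> 0"
  unfolding det_nonzero_iff_ker
proof (intro allI impI)
  fix c assume c: "cross_gram x x *v c = 0"
  let ?s = "\<Sum>k\<in>UNIV. c $ k *\<^sub>C x k"
  have "cinner ?s (x l) = 0" for l
    using c by (simp add: cross_gram_mult_vector vec_eq_iff)
  then have "cinner ?s ?s = 0"
    by (subst cinner_sum_right) (simp add: cinner_scaleC_right)
  then have "?s = 0" by (simp add: cinner_self)
  then show "c = 0"
    using assms unfolding independent_family_def by (simp add: vec_eq_iff)
qed

lemma det_cross_gram_imp_independent:
  assumes "det (cross_gram x y) \<noteq> 0"
  shows "independent_family y"
  unfolding independent_family_def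
proof (intro allI impI)
  fix c j assume "(\<Sum>j\<in>UNIV. c j *\<^sub>C y j) = 0"
  then have "cross_gram x y *v (\<chi> j. c j) = 0"
    by (simp add: cross_gram_mult_vector vec_eq_iff)
  then have "(\<chi> j. c j) = 0" using assms det_nonzero_iff_ker by blast
  then show "c j = 0" by (metis vec_lambda_beta zero_index)
qed

section \<open>The open mapping theorem and vector-valued power series\<close>

lemma open_mapping_bound:
  fixes A :: "'a::banach \<Rightarrow> 'b::banach"
  assumes A: "bounded_linear A" "surj A"
  obtains C where "C > 0" "\<And>y. \<exists>x. A x = y \<and> norm x \<le> C * norm y"
proof -
  interpret bounded_linear A by fact
  define F where "F n = closure (A ` cball 0 (real n))" for n
  have "(\<Union>n. F n) = UNIV"
  proof safe
    fix y
    obtain x where "y = A x" using A(2) by blast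
    moreover obtain n where "norm x \<le> real n" using real_arch_simple by blast
    ultimately have "y \<in> F n" unfolding F_def using closure_subset by fastforce
    then show "y \<in> (\<Union>n. F n)" by blast
  qed simp
  then have UN: "Met_TC.mtopology interior_of \<Union>(range F) \<noteq> {}"
    by simp
  have "Met_TC.mcomplete TYPE('b)"
    by (simp add: complete_UNIV)
  then have "\<exists>n. interior (F n) \<noteq> {}"
  proof (rule_tac ccontr)
    assume "Met_TC.mcomplete TYPE('b)" "\<not> (\<exists>n. interior (F n) \<noteq> {})"
    then have "Met_TC.mtopology interior_of \<Union>(range F) = {}"
      by (intro Met_TC.metric_Baire_category_alt) (auto simp: F_def)
    then show False using UN by simp
  qed
  then obtain n where "interior (F n) \<noteq> {}" ..
  then obtain y0 r where r: "r > 0" "ball y0 r \<subseteq> F n"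
    by (metis ex_in_conv mem_interior)
  have approx: "\<exists>x. norm x \<le> 2 * real n \<and> norm (A x - y) < e" if "norm y < r" "e > 0" for y e
  proof -
    have "y0 + y \<in> F n" "y0 \<in> F n"
      using r that by (auto simp: dist_norm subset_eq)
    then have "\<exists>v\<in>A ` cball 0 (real n). dist v (y0 + y) < e/2" "\<exists>v\<in>A ` cball 0 (real n). dist v y0 < e/2"
      using half_gt_zero[OF \<open>e > 0\<close>] unfolding F_def closure_approachable by blast+
    then obtain x1 x2 where x: "norm x1 \<le> real n" "dist (A x1) (y0 + y) < e/2"
       "norm x2 \<le> real n" "dist (A x2) y0 < e/2"
      by (auto simp: dist_norm)
    have "norm (A (x1 - x2) - y) = norm ((A x1 - (y0 + y)) - (A x2 - y0))"
      by (simp add: diff algebra_simps)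
    also have "\<dots> \<le> norm (A x1 - (y0 + y)) + norm (A x2 - y0)"
      by (rule norm_triangle_ineq4)
    finally have "norm (A (x1 - x2) - y) < e"
      using x(2,4) by (simp add: dist_norm)
    moreover have "norm (x1 - x2) \<le> 2 * real n"
      using norm_triangle_ineq4[of x1 x2] x(1,3) by linarith
    ultimately show ?thesis by blast
  qed
  define K where "K = 4 * real n / r"
  have K: "K \<ge> 0" using r by (simp add: K_def)
  have "\<exists>x. norm x \<le> K * norm y \<and> norm (A x - y) \<le> norm y / 2" for y
  proof (cases "y = 0")
    case True
    then show ?thesis by (intro exI[of _ 0]) (simp add: zero)
  next
    case False
    define t where "t = r / (2 * norm y)"
    have t: "t > 0" using False r by (simp add: t_def)
    have "norm (t *\<^sub>R y) < r" using False r by (simp add: t_def)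
    with approx[of "t *\<^sub>R y" "r / 4"] obtain x
      where x: "norm x \<le> 2 * real n" "norm (A x - t *\<^sub>R y) < r / 4"
      using r by auto
    have "A ((1/t) *\<^sub>R x) - y = (1/t) *\<^sub>R (A x - t *\<^sub>R y)"
      using t by (simp add: scaleR algebra_simps)
    then have "norm (A ((1/t) *\<^sub>R x) - y) = norm (A x - t *\<^sub>R y) / t"
      using t by simp
    also have "\<dots> \<le> r / 4 / t" using x t by (intro divide_right_mono) auto
    also have "\<dots> = norm y / 2" using False r by (simp add: t_def)
    finally have 1: "norm (A ((1/t) *\<^sub>R x) - y) \<le> norm y / 2" .
    have "norm ((1/t) *\<^sub>R x) \<le> 2 * real n / t"
      using x t by (simp add: divide_right_mono)
    also have "\<dots> = K * norm y" by (simp add: t_def K_def)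
    finally show ?thesis using 1 by blast
  qed
  then obtain g where g: "\<And>y. norm (g y) \<le> K * norm y" "\<And>y. norm (A (g y) - y) \<le> norm y / 2"
    by metis
  have main: "\<exists>x. A x = y \<and> norm x \<le> (2 * K + 1) * norm y" for y
  proof -
    define s where "s k = ((\<lambda>v. v - A (g v)) ^^ k) y" for k
    have s_Suc: "s (Suc k) = s k - A (g (s k))" for k by (simp add: s_def)
    have s_le: "norm (s k) \<le> norm y * (1/2)^k" for k
    proof (induction k)
      case (Suc k)
      have "norm (s (Suc k)) \<le> norm (s k) / 2"
        using g(2)[of "s k"] by (simp add: s_Suc norm_minus_commute)
      then show ?case using Suc by simp
    qed (simp add: s_def)
    have geo: "(\<lambda>k. K * norm y * (1/2)^k) sums (K * norm y * 2)"
      using sums_mult[OF geometric_sums[of "1/2 :: real"], of "K * norm y"] by simp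
    have gs: "norm (g (s k)) \<le> K * norm y * (1/2)^k" for k
      using g(1)[of "s k"] mult_left_mono[OF s_le[of k] K] by (simp add: mult.assoc)
    have sm: "summable (\<lambda>k. norm (g (s k)))"
      using gs by (intro summable_comparison_test'[OF sums_summable[OF geo], of 0]) auto
    define x where "x = (\<Sum>k. g (s k))"
    have "norm x \<le> (\<Sum>k. norm (g (s k)))"
      unfolding x_def by (rule summable_norm[OF sm])
    also have "\<dots> \<le> (\<Sum>k. K * norm y * (1/2)^k)"
      by (rule suminf_le[OF gs sm sums_summable[OF geo]])
    also have "\<dots> = 2 * K * norm y" using sums_unique[OF geo] by simp
    finally have "norm x \<le> (2 * K + 1) * norm y"
      using norm_ge_zero[of y] by (simp only: distrib_right)
    moreover have "A x = y"
    proof -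
      have "(\<lambda>k. A (g (s k))) sums A x"
        unfolding x_def by (intro sums summable_sums summable_norm_cancel[OF sm])
      moreover have "s \<longlonglongrightarrow> 0"
      proof (rule Lim_null_comparison)
        show "(\<lambda>k. norm y * (1/2)^k) \<longlonglongrightarrow> 0"
          by (intro tendsto_mult_right_zero LIMSEQ_power_zero) simp
      qed (simp add: s_le)
      then have "(\<lambda>k. s k - s (Suc k)) sums (s 0 - 0)"
        by (rule telescope_sums')
      then have "(\<lambda>k. A (g (s k))) sums y"
        by (simp add: s_Suc) (simp add: s_def)
      ultimately show ?thesis by (rule sums_unique2)
    qed
    ultimately show ?thesis by blast
  qed
  show ?thesis by (rule that[of "2 * K + 1"]) (use K main in auto)
qed

definition has_deriv_C :: "(complex \<Rightarrow> 'a::chilbert_space) \<Rightarrow> 'a \<Rightarrow> complex \<Rightarrow> bool" where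
  "has_deriv_C f d z \<longleftrightarrow> (f has_derivative (\<lambda>h. h *\<^sub>C d)) (at z)"

lemma power_series_has_deriv_C:
  fixes x :: "nat \<Rightarrow> 'a::chilbert_space"
  assumes x: "\<And>k. norm (x k) \<le> M * C ^ k" and C: "C > 0"
  shows power_series_summable: "w \<in> ball z (1 / (4 * C)) \<Longrightarrow> summable (\<lambda>k. (w - z) ^ k *\<^sub>C x k)"
    and "w \<in> ball z (1 / (4 * C)) \<Longrightarrow>
      has_deriv_C (\<lambda>w. \<Sum>k. (w - z) ^ k *\<^sub>C x k) (\<Sum>k. (w - z) ^ k *\<^sub>C of_nat (Suc k) *\<^sub>C x (Suc k)) w"
    and "norm (of_nat (Suc k) *\<^sub>C x (Suc k)) \<le> (M * C) * (2 * C) ^ k"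
proof -
  let ?S = "ball z (1 / (4 * C))"
  let ?d = "\<lambda>i w. (of_nat i * (w - z) ^ (i - 1)) *\<^sub>C x i"
  have M: "M \<ge> 0" using order_trans[OF norm_ge_zero x[of 0]] by simp
  have bound: "norm (of_nat (Suc k) *\<^sub>C x (Suc k)) \<le> (M * C) * (2 * C) ^ k" for k
  proof -
    have "Suc k \<le> 2 ^ k" by (simp add: Suc_leI)
    then have "real (Suc k) \<le> 2 ^ k" by (metis of_nat_le_iff of_nat_numeral of_nat_power)
    then have "real (Suc k) * norm (x (Suc k)) \<le> 2 ^ k * (M * C ^ Suc k)"
      using x[of "Suc k"] by (intro mult_mono) auto
    then show ?thesis by (simp add: norm_scaleC power_mult_distrib mult_ac del: of_nat_Suc)
  qed
  show "norm (of_nat (Suc k) *\<^sub>C x (Suc k)) \<le> (M * C) * (2 * C) ^ k" by (rule bound)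
  have wz: "cmod (w - z) \<le> 1 / (4 * C)" if "w \<in> ?S" for w
    using that by (simp add: dist_norm norm_minus_commute)
  have summ: "summable (\<lambda>k. (w - z) ^ k *\<^sub>C x k)" if "w \<in> ?S" for w
  proof (rule summable_comparison_test'[of "\<lambda>k. M * (1/2) ^ k" 0])
    fix k
    have "norm ((w - z) ^ k *\<^sub>C x k) \<le> (1 / (4 * C)) ^ k * (M * C ^ k)"
      unfolding norm_scaleC norm_power
      by (intro mult_mono power_mono wz[OF that] x) (use C in auto)
    also have "\<dots> = M * (1 / 4) ^ k" using C by (simp add: power_divide power_mult_distrib)
    also have "\<dots> \<le> M * (1 / 2) ^ k" using M by (intro mult_left_mono power_mono) auto
    finally show "norm ((w - z) ^ k *\<^sub>C x k) \<le> M * (1/2) ^ k" .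
  qed (intro summable_mult, simp)
  show "w \<in> ?S \<Longrightarrow> summable (\<lambda>k. (w - z) ^ k *\<^sub>C x k)" by (rule summ)
  have d_le: "norm (?d i w) \<le> (2 * M * C) * (1/2) ^ i" if "w \<in> ?S" for i w
  proof (cases i)
    case 0
    then show ?thesis using M C by simp
  next
    case (Suc k)
    have "norm (?d i w) = cmod (w - z) ^ k * norm (of_nat (Suc k) *\<^sub>C x (Suc k))"
      by (simp add: Suc norm_scaleC norm_mult norm_power mult_ac del: of_nat_Suc)
    also have "\<dots> \<le> (1 / (4 * C)) ^ k * ((M * C) * (2 * C) ^ k)"
      by (intro mult_mono power_mono wz[OF that] bound) (use C in auto)
    also have "\<dots> = (M * C) * ((1 / (4 * C)) * (2 * C)) ^ k"
      unfolding power_mult_distrib by simp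
    also have "(1 / (4 * C)) * (2 * C) = 1 / 2" using C by simp
    finally show ?thesis by (simp add: Suc)
  qed
  have geo: "summable (\<lambda>i. (2 * M * C) * (1/2 :: real) ^ i)"
    by (intro summable_mult) simp
  have unif: "uniform_limit ?S (\<lambda>n w. \<Sum>i<n. ?d i w) (\<lambda>w. \<Sum>i. ?d i w) sequentially"
    by (rule Weierstrass_m_test[OF _ geo]) (rule d_le)
  have ex: "\<exists>g. \<forall>w\<in>?S. (\<lambda>k. (w - z) ^ k *\<^sub>C x k) sums g w \<and>
      (g has_derivative (\<lambda>h. h *\<^sub>C (\<Sum>i. ?d i w))) (at w within ?S)" if w: "w \<in> ?S"
  proof (rule has_derivative_series[where f' = "\<lambda>i w h. h *\<^sub>C ?d i w" and x = w])
    fix k v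
    have "((\<lambda>w. (w - z) ^ k) has_field_derivative of_nat k * (v - z) ^ (k - 1)) (at v within ?S)"
      by (auto intro!: derivative_eq_intros)
    then have "((\<lambda>w. (w - z) ^ k) has_derivative (\<lambda>h. (of_nat k * (v - z) ^ (k - 1)) * h)) (at v within ?S)"
      by (simp add: has_field_derivative_def)
    from bounded_linear.has_derivative[OF bounded_bilinear.bounded_linear_left[OF bounded_bilinear_scaleC] this]
    show "((\<lambda>w. (w - z) ^ k *\<^sub>C x k) has_derivative (\<lambda>h. h *\<^sub>C ?d k v)) (at v within ?S)"
      by (simp add: scaleC_scaleC mult_ac)
  next
    fix e :: real assume "e > 0"
    from uniform_limitD[OF unif this]
    show "\<forall>\<^sub>F n in sequentially. \<forall>w\<in>?S. \<forall>h. norm ((\<Sum>i<n. h *\<^sub>C ?d i w) - h *\<^sub>C (\<Sum>i. ?d i w)) \<le> e * norm h"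
    proof (rule eventually_mono, intro ballI allI)
      fix n v h assume "\<forall>v\<in>?S. dist (\<Sum>i<n. ?d i v) (\<Sum>i. ?d i v) < e" "v \<in> ?S"
      then have "dist (\<Sum>i<n. ?d i v) (\<Sum>i. ?d i v) < e" by blast
      then have "norm ((\<Sum>i<n. ?d i v) - (\<Sum>i. ?d i v)) \<le> e" unfolding dist_norm by (rule less_imp_le)
      then have "norm (h *\<^sub>C ((\<Sum>i<n. ?d i v) - (\<Sum>i. ?d i v))) \<le> e * norm h"
        using mult_left_mono[of _ e "cmod h"] by (simp only: norm_scaleC norm_ge_zero mult.commute[of e])
      then show "norm ((\<Sum>i<n. h *\<^sub>C ?d i v) - h *\<^sub>C (\<Sum>i. ?d i v)) \<le> e * norm h"
        by (simp add: complex_vector.scale_right_diff_distrib complex_vector.scale_sum_right)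
    qed
  qed (use w summ summable_sums in auto)
  show "has_deriv_C (\<lambda>w. \<Sum>k. (w - z) ^ k *\<^sub>C x k) (\<Sum>k. (w - z) ^ k *\<^sub>C of_nat (Suc k) *\<^sub>C x (Suc k)) w"
    if w: "w \<in> ?S"
  proof -
    obtain g where g0: "\<forall>w\<in>?S. (\<lambda>k. (w - z) ^ k *\<^sub>C x k) sums g w \<and>
        (g has_derivative (\<lambda>h. h *\<^sub>C (\<Sum>i. ?d i w))) (at w within ?S)"
      using ex[OF w] ..
    have g: "(\<lambda>k. (v - z) ^ k *\<^sub>C x k) sums g v" if "v \<in> ?S" for v
      using bspec[OF g0 that] by (rule conjunct1)
    have "(g has_derivative (\<lambda>h. h *\<^sub>C (\<Sum>i. ?d i w))) (at w within ?S)"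
      using bspec[OF g0 w] by (rule conjunct2)
    then have "(g has_derivative (\<lambda>h. h *\<^sub>C (\<Sum>i. ?d i w))) (at w)"
      by (simp only: at_within_open[OF w open_ball])
    then have "((\<lambda>w. \<Sum>k. (w - z) ^ k *\<^sub>C x k) has_derivative (\<lambda>h. h *\<^sub>C (\<Sum>i. ?d i w))) (at w)"
      by (rule has_derivative_transform_within_open[OF _ open_ball w]) (rule sums_unique[OF g])
    moreover have "(\<Sum>i. ?d i w) = (\<Sum>k. ?d (Suc k) w)"
      using suminf_split_head[OF summable_comparison_test'[OF geo d_le[OF w]]] by simp
    ultimately show ?thesis
      by (simp add: has_deriv_C_def scaleC_scaleC mult.commute del: of_nat_Suc)
  qed
qed

section \<open>Holomorphic frames\<close>

lemma has_deriv_C_add: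
  assumes "has_deriv_C f d z" "has_deriv_C g e z"
  shows "has_deriv_C (\<lambda>w. f w + g w) (d + e) z"
  using has_derivative_add[OF assms[unfolded has_deriv_C_def]]
  by (simp add: has_deriv_C_def scaleC_add_right)

lemma has_deriv_C_sum:
  assumes "\<And>i. i \<in> I \<Longrightarrow> has_deriv_C (f i) (d i) z"
  shows "has_deriv_C (\<lambda>w. \<Sum>i\<in>I. f i w) (\<Sum>i\<in>I. d i) z"
  using has_derivative_sum[of I f "\<lambda>i h. h *\<^sub>C d i" "at z"] assms
  by (simp add: has_deriv_C_def complex_vector.scale_sum_right)

lemma has_deriv_C_scaleC:
  assumes "(c has_field_derivative c') (at z)" "has_deriv_C f d z"
  shows "has_deriv_C (\<lambda>w. c w *\<^sub>C f w) (c' *\<^sub>C f z + c z *\<^sub>C d) z"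
  using bounded_bilinear.FDERIV[OF bounded_bilinear_scaleC
      assms(1)[unfolded has_field_derivative_def] assms(2)[unfolded has_deriv_C_def]]
  by (simp add: has_deriv_C_def scaleC_add_right scaleC_scaleC mult.commute add.commute)

lemma has_deriv_C_transform:
  assumes "has_deriv_C f d z" "open U" "z \<in> U" "\<And>w. w \<in> U \<Longrightarrow> f w = g w"
  shows "has_deriv_C g d z"
  using has_derivative_transform_within_open[OF assms(1)[unfolded has_deriv_C_def] assms(2-4)]
  unfolding has_deriv_C_def by simp

lemma has_deriv_C_compose:
  assumes "has_deriv_C f d (\<phi> z)" "(\<phi> has_field_derivative \<phi>') (at z)"
  shows "has_deriv_C (\<lambda>w. f (\<phi> w)) (\<phi>' *\<^sub>C d) z"
  using has_derivative_compose[OF assms(2)[unfolded has_field_derivative_def] assms(1)[unfolded has_deriv_C_def]]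
  by (simp add: has_deriv_C_def scaleC_scaleC mult.commute)

lemma has_wirtinger_cinner:
  assumes "has_deriv_C f d z" "has_deriv_C g e z"
  shows "has_wirtinger (\<lambda>w. cinner (f w) (g w)) (cinner d (g z)) (cinner (f z) e) z"
  using bounded_bilinear.FDERIV[OF bounded_bilinear_cinner assms[unfolded has_deriv_C_def]]
  by (simp add: has_wirtinger_def cinner_scaleC_left cinner_scaleC_right add.commute)

lemma has_field_derivative_cinner:
  assumes "has_deriv_C f d z"
  shows "((\<lambda>w. cinner (f w) x) has_field_derivative cinner d x) (at z)"
  using bounded_linear.has_derivative[OF bounded_bilinear.bounded_linear_left[OF bounded_bilinear_cinner]
      assms[unfolded has_deriv_C_def], of x]
  by (simp add: has_field_derivative_def cinner_scaleC_left mult_commute_abs)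

definition deriv_C_on :: "(complex \<Rightarrow> 'a::chilbert_space) \<Rightarrow> (complex \<Rightarrow> 'a) \<Rightarrow> complex set \<Rightarrow> bool" where
  "deriv_C_on f f' U \<longleftrightarrow> (\<forall>z\<in>U. has_deriv_C f (f' z) z)"

lemma holomorphic_vec_on_iff:
  assumes "open U"
  shows "holomorphic_vec_on f U \<longleftrightarrow> (\<exists>f'. deriv_C_on f f' U)"
  using bchoice_iff[of U "\<lambda>z d. (f has_derivative (\<lambda>h. h *\<^sub>C d)) (at z)"]
  unfolding holomorphic_vec_on_def deriv_C_on_def has_deriv_C_def
  by (simp add: at_within_open[OF _ assms] cong: ball_cong)

lemma holomorphic_on_cinner:
  assumes "deriv_C_on f f' U" "open U"
  shows "(\<lambda>w. cinner (f w) x) holomorphic_on U"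
  using assms has_field_derivative_cinner
  unfolding deriv_C_on_def holomorphic_on_open[OF assms(2)] by blast

text \<open>Inner products with the fixed vectors \<open>\<delta> l z\<close> turn the relation between the frames into a
  system of scalar linear equations, whose solution is holomorphic by Cramer's rule.\<close>

lemma transition_matrix:
  fixes \<gamma> \<delta> :: "'n::finite \<Rightarrow> complex \<Rightarrow> 'a::chilbert_space"
  assumes U: "open U" "z \<in> U"
    and \<gamma>: "\<And>i. holomorphic_vec_on (\<gamma> i) U" and \<delta>: "\<And>i. holomorphic_vec_on (\<delta> i) U"
    and ind: "independent_family (\<lambda>i. \<delta> i z)"
    and span: "\<And>w i. w \<in> U \<Longrightarrow> \<gamma> i w \<in> complex_vector.span (range (\<lambda>i. \<delta> i w))"
  obtains V and a :: "complex \<Rightarrow> complex^'n^'n" where "open V" "z \<in> V" "V \<subseteq> U"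
    "\<And>i j. (\<lambda>w. a w $ i $ j) holomorphic_on V"
    "\<And>w j. w \<in> V \<Longrightarrow> \<gamma> j w = (\<Sum>k\<in>UNIV. a w $ k $ j *\<^sub>C \<delta> k w)"
proof -
  let ?x = "\<lambda>l. \<delta> l z"
  let ?A = "\<lambda>w. cross_gram ?x (\<lambda>i. \<delta> i w)"
  let ?B = "\<lambda>w. cross_gram ?x (\<lambda>i. \<gamma> i w)"
  have hol: "(\<lambda>w. ?B w $ i $ j) holomorphic_on U" "(\<lambda>w. ?A w $ i $ j) holomorphic_on U" for i j
    using \<gamma> \<delta> holomorphic_on_cinner U(1) unfolding holomorphic_vec_on_iff[OF U(1)] cross_gram_def
    by fastforce+
  define V where "V = {w \<in> U. det (?A w) \<noteq> 0}"
  have "continuous_on U (\<lambda>w. det (?A w))"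
    by (intro holomorphic_on_imp_continuous_on holomorphic_on_det hol)
  then have "open V"
    using continuous_open_preimage[of U "\<lambda>w. det (?A w)" "- {0}"] U(1)
    by (simp add: V_def vimage_def Int_def open_Compl)
  define a where "a w = matrix_inv (?A w) ** ?B w" for w
  have "V \<subseteq> U" by (auto simp: V_def)
  note hol' = hol[THEN holomorphic_on_subset, OF this]
  have holV: "(\<lambda>w. ?B w $ i $ j) holomorphic_on V" "(\<lambda>w. matrix_inv (?A w) $ i $ j) holomorphic_on V" for i j
    by (rule hol', rule holomorphic_on_matrix_inv[OF hol'(2)]) (simp add: V_def)
  show ?thesis
  proof (rule that[of V a])
    show "z \<in> V" using U(2) det_cross_gram_self[OF ind] by (simp add: V_def)
    show "(\<lambda>w. a w $ i $ j) holomorphic_on V" for i j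
      unfolding a_def matrix_matrix_mult_def by (auto intro!: holomorphic_intros holV)
    fix w j assume w: "w \<in> V"
    then obtain c where c: "\<gamma> j w = (\<Sum>k\<in>UNIV. c k *\<^sub>C \<delta> k w)"
      using span_range_family[OF span] unfolding V_def by blast
    have "?A w *v (\<chi> k. c k) = column j (?B w)"
      unfolding cross_gram_mult_vector by (simp add: vec_eq_iff column_def cross_gram_def c)
    moreover have "column j (a w) = matrix_inv (?A w) *v column j (?B w)"
      by (simp add: a_def column_def vec_eq_iff matrix_matrix_mult_def matrix_vector_mult_def)
    ultimately have "column j (a w) = (\<chi> k. c k)"
      using matrix_inv_left_right(1)[of "?A w"] w by (metis (mono_tags, lifting) V_def matrix_vector_mul_assoc
          matrix_vector_mul_lid mem_Collect_eq)
    then have "a w $ k $ j = c k" for k by (simp add: column_def vec_eq_iff)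
    then show "\<gamma> j w = (\<Sum>k\<in>UNIV. a w $ k $ j *\<^sub>C \<delta> k w)" by (simp add: c)
  qed (use \<open>open V\<close> in \<open>auto simp: V_def\<close>)
qed

lemma gram_transition:
  assumes "\<And>j. x j = (\<Sum>k\<in>UNIV. a $ k $ j *\<^sub>C y k)"
  shows "cross_gram x x = adjoint_matrix a ** cross_gram y y ** a"
proof -
  have "cinner (x j) (x i) = (\<Sum>k\<in>UNIV. \<Sum>l\<in>UNIV. a $ k $ j * (cnj (a $ l $ i) * cinner (y k) (y l)))" for i j
    unfolding assms cinner_sum_left unfolding cinner_sum_right
    by (simp add: cinner_scaleC_left cinner_scaleC_right mult.left_commute)
  then show ?thesis
    by (simp add: vec_eq_iff cross_gram_def adjoint_matrix_def matrix_matrix_mult_def sum_distrib_right sum_distrib_left mult_ac)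
qed

definition twice_deriv_C_on :: "(complex \<Rightarrow> 'a::chilbert_space) \<Rightarrow> (complex \<Rightarrow> 'a) \<Rightarrow> complex set \<Rightarrow> bool" where
  "twice_deriv_C_on f f' U \<longleftrightarrow> deriv_C_on f f' U \<and> (\<exists>f''. deriv_C_on f' f'' U)"

definition frame_on :: "('a::chilbert_space \<Rightarrow> 'a) \<Rightarrow> ('n::finite \<Rightarrow> complex \<Rightarrow> 'a) \<Rightarrow> complex set \<Rightarrow> bool" where
  "frame_on T \<gamma> U \<longleftrightarrow> open U \<and> (\<forall>i. \<exists>\<gamma>'. twice_deriv_C_on (\<gamma> i) \<gamma>' U) \<and>
     (\<forall>w\<in>U. independent_family (\<lambda>i. \<gamma> i w) \<and>
        complex_vector.span (range (\<lambda>i. \<gamma> i w)) = eigenspace T w)"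

lemma shift_bounded_linear:
  assumes "bounded_clinear T"
  shows "bounded_linear (shift T w)" "shift T w (c *\<^sub>C x) = c *\<^sub>C shift T w x"
proof -
  show "bounded_linear (shift T w)"
    using assms unfolding shift_def bounded_clinear_def
    by (intro bounded_linear_sub bounded_linear_scaleC_right) auto
  show "shift T w (c *\<^sub>C x) = c *\<^sub>C shift T w x"
    using assms by (simp add: shift_def bounded_clinear_def complex_vector.scale_right_diff_distrib
        scaleC_scaleC mult.commute)
qed

lemma subspace_eigenspace:
  assumes "bounded_clinear T"
  shows "complex_vector.subspace (eigenspace T w)"
proof (rule complex_vector.subspaceI)
  interpret bounded_linear "shift T w" by (rule shift_bounded_linear[OF assms])
  show "0 \<in> eigenspace T w" by (simp add: eigenspace_def zero)
  show "x + y \<in> eigenspace T w" if "x \<in> eigenspace T w" "y \<in> eigenspace T w" for x y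
    using that by (simp add: eigenspace_def add)
  show "c *\<^sub>C x \<in> eigenspace T w" if "x \<in> eigenspace T w" for c x
    using that by (simp add: eigenspace_def shift_bounded_linear(2)[OF assms])
qed

lemma exists_frame_on:
  fixes T :: "'a::chilbert_space \<Rightarrow> 'a"
  assumes T: "T \<in> cowen_douglas CARD('n) \<Omega>" and \<Omega>: "open \<Omega>" "z \<in> \<Omega>"
  obtains \<gamma> :: "'n::finite \<Rightarrow> complex \<Rightarrow> 'a" and U where "frame_on T \<gamma> U" "z \<in> U" "U \<subseteq> \<Omega>"
proof -
  have cl: "bounded_clinear T" and surj: "surj (shift T z)"
    and dim: "\<And>w. w \<in> \<Omega> \<Longrightarrow> complex_vector.dim (eigenspace T w) = CARD('n)"
    using T \<Omega>(2) unfolding cowen_douglas_def by auto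
  note lin = shift_bounded_linear[OF cl]
  obtain C where C: "C > 0" "\<And>y. \<exists>x. shift T z x = y \<and> norm x \<le> C * norm y"
    using open_mapping_bound[OF lin(1) surj] by blast
  then obtain g where g: "\<And>y. shift T z (g y) = y" "\<And>y. norm (g y) \<le> C * norm y"
    by metis
  obtain x0 :: "'n \<Rightarrow> 'a" where x0: "independent_family x0" "\<And>i. x0 i \<in> eigenspace T z"
    using exists_basis_family[OF dim[OF \<Omega>(2)]] by blast
  define x where "x i k = (g ^^ k) (x0 i)" for i k
  have x_Suc: "shift T z (x i (Suc k)) = x i k" for i k by (simp add: x_def g)
  have x_0: "shift T z (x i 0) = 0" for i using x0(2) by (simp add: x_def eigenspace_def)
  have x_le: "norm (x i k) \<le> norm (x0 i) * C ^ k" for i k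
  proof (induction k)
    case (Suc k)
    have "norm (x i (Suc k)) \<le> C * norm (x i k)" using g(2) by (simp add: x_def)
    also have "\<dots> \<le> C * (norm (x0 i) * C ^ k)" using Suc C(1) by (intro mult_left_mono) auto
    finally show ?case by (simp add: mult_ac)
  qed (simp add: x_def)
  define \<gamma> where "\<gamma> i w = (\<Sum>k. (w - z) ^ k *\<^sub>C x i k)" for i w
  define y where "y i k = of_nat (Suc k) *\<^sub>C x i (Suc k)" for i k
  define \<gamma>' where "\<gamma>' i w = (\<Sum>k. (w - z) ^ k *\<^sub>C y i k)" for i w
  have y_le: "norm (y i k) \<le> (norm (x0 i) * C) * (2 * C) ^ k" for i k
    unfolding y_def by (rule power_series_has_deriv_C(3)[OF x_le C(1)])
  define B where "B = ball z (1 / (8 * C)) \<inter> \<Omega>"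
  have "1 / (8 * C) \<le> 1 / (4 * C)" using C(1) by (simp add: field_simps)
  then have B1: "w \<in> ball z (1 / (4 * C))" if "w \<in> B" for w
    using that unfolding B_def by auto
  have B2: "w \<in> ball z (1 / (4 * (2 * C)))" if "w \<in> B" for w
    using that unfolding B_def by simp
  have twice: "twice_deriv_C_on (\<gamma> i) (\<gamma>' i) B" for i
  proof -
    have "deriv_C_on (\<gamma> i) (\<gamma>' i) B"
      unfolding deriv_C_on_def \<gamma>_def \<gamma>'_def y_def
      by (intro ballI power_series_has_deriv_C(2)[OF x_le C(1) B1])
    moreover have "deriv_C_on (\<gamma>' i) (\<lambda>w. \<Sum>k. (w - z) ^ k *\<^sub>C of_nat (Suc k) *\<^sub>C y i (Suc k)) B"
      unfolding deriv_C_on_def \<gamma>'_def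
      by (intro ballI power_series_has_deriv_C(2)[OF y_le _ B2]) (use C in auto)
    ultimately show ?thesis unfolding twice_deriv_C_on_def by blast
  qed
  have eig: "\<gamma> i w \<in> eigenspace T w" if "w \<in> B" for i w
  proof -
    have sm: "summable (\<lambda>k. (w - z) ^ k *\<^sub>C x i k)"
      by (rule power_series_summable[OF x_le C(1) B1[OF that]])
    have "(\<lambda>k. shift T z ((w - z) ^ k *\<^sub>C x i k)) sums shift T z (\<gamma> i w)"
      unfolding \<gamma>_def by (rule bounded_linear.sums[OF lin(1) summable_sums[OF sm]])
    then have 1: "(\<lambda>k. (w - z) ^ Suc k *\<^sub>C shift T z (x i (Suc k))) sums shift T z (\<gamma> i w)"
      by (subst sums_Suc_iff) (simp add: lin(2) x_0)
    have "(\<lambda>k. (w - z) *\<^sub>C ((w - z) ^ k *\<^sub>C x i k)) sums ((w - z) *\<^sub>C \<gamma> i w)"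
      unfolding \<gamma>_def by (rule bounded_linear.sums[OF bounded_linear_scaleC_right summable_sums[OF sm]])
    then have "shift T z (\<gamma> i w) = (w - z) *\<^sub>C \<gamma> i w"
      using 1 by (simp add: scaleC_scaleC x_Suc sums_unique2)
    then show ?thesis
      by (simp add: eigenspace_def shift_def complex_vector.scale_left_diff_distrib algebra_simps)
  qed
  have \<gamma>z: "\<gamma> i z = x0 i" for i
    unfolding \<gamma>_def using suminf_finite[of "{0}" "\<lambda>k. 0 ^ k *\<^sub>C x i k"]
    by (simp add: power_0_left x_def scaleC_one)
  define U where "U = {w \<in> B. det (cross_gram x0 (\<lambda>i. \<gamma> i w)) \<noteq> 0}"
  have "open B" using \<Omega>(1) by (simp add: B_def open_Int)
  have "continuous_on B (\<lambda>w. det (cross_gram x0 (\<lambda>i. \<gamma> i w)))"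
    by (intro holomorphic_on_imp_continuous_on holomorphic_on_det)
       (use twice \<open>open B\<close> in \<open>auto simp: cross_gram_def twice_deriv_C_on_def intro!: holomorphic_on_cinner\<close>)
  then have "open U"
    using continuous_open_preimage[of B "\<lambda>w. det (cross_gram x0 (\<lambda>i. \<gamma> i w))" "- {0}"] \<open>open B\<close>
    by (simp add: U_def vimage_def Int_def open_Compl)
  have UB: "U \<subseteq> B" by (auto simp: U_def)
  have "frame_on T \<gamma> U"
    unfolding frame_on_def
  proof (intro conjI allI ballI)
    show "\<exists>\<gamma>'. twice_deriv_C_on (\<gamma> i) \<gamma>' U" for i
      using twice[of i] UB unfolding twice_deriv_C_on_def deriv_C_on_def by (blast dest: subsetD)
    fix w assume w: "w \<in> U"
    show "independent_family (\<lambda>i. \<gamma> i w)"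
      using w det_cross_gram_imp_independent unfolding U_def by blast
    moreover have "w \<in> B" "w \<in> \<Omega>" using w UB by (auto simp: B_def)
    ultimately show "complex_vector.span (range (\<lambda>i. \<gamma> i w)) = eigenspace T w"
      by (intro independent_family_spans subspace_eigenspace cl eig dim)
  qed (fact \<open>open U\<close>)
  moreover have "z \<in> U"
    using C(1) \<Omega>(2) det_cross_gram_self[OF x0(1)] by (simp add: U_def B_def \<gamma>z)
  moreover have "U \<subseteq> \<Omega>" using UB by (auto simp: B_def)
  ultimately show ?thesis by (rule that)
qed

lemma deriv_C_on_subset: "deriv_C_on f f' U \<Longrightarrow> V \<subseteq> U \<Longrightarrow> deriv_C_on f f' V"
  unfolding deriv_C_on_def by blast

lemma deriv_C_on_scaleC:
  assumes "c holomorphic_on U" "open U" "deriv_C_on f f' U"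
  shows "deriv_C_on (\<lambda>w. c w *\<^sub>C f w) (\<lambda>w. deriv c w *\<^sub>C f w + c w *\<^sub>C f' w) U"
  using assms unfolding deriv_C_on_def
  by (auto intro!: has_deriv_C_scaleC holomorphic_derivI)

lemma twice_deriv_C_on_scaleC:
  assumes c: "c holomorphic_on U" "open U" and f: "twice_deriv_C_on f f' U"
  shows "twice_deriv_C_on (\<lambda>w. c w *\<^sub>C f w) (\<lambda>w. deriv c w *\<^sub>C f w + c w *\<^sub>C f' w) U"
proof -
  obtain f'' where f'': "deriv_C_on f f' U" "deriv_C_on f' f'' U"
    using f unfolding twice_deriv_C_on_def by blast
  from deriv_C_on_scaleC[OF holomorphic_deriv[OF c] c(2) f''(1)] deriv_C_on_scaleC[OF c f''(2)]
  have "deriv_C_on (\<lambda>w. deriv c w *\<^sub>C f w + c w *\<^sub>C f' w)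
    (\<lambda>w. (deriv (deriv c) w *\<^sub>C f w + deriv c w *\<^sub>C f' w) + (deriv c w *\<^sub>C f' w + c w *\<^sub>C f'' w)) U"
    unfolding deriv_C_on_def by (auto intro!: has_deriv_C_add)
  then show ?thesis
    using deriv_C_on_scaleC[OF c f''(1)] unfolding twice_deriv_C_on_def by blast
qed

lemma twice_deriv_C_on_sum:
  assumes "\<And>i. i \<in> I \<Longrightarrow> twice_deriv_C_on (f i) (f' i) U"
  shows "twice_deriv_C_on (\<lambda>w. \<Sum>i\<in>I. f i w) (\<lambda>w. \<Sum>i\<in>I. f' i w) U"
proof -
  obtain f'' where "\<And>i. i \<in> I \<Longrightarrow> deriv_C_on (f' i) (f'' i) U"
    using assms unfolding twice_deriv_C_on_def by metis
  then have "deriv_C_on (\<lambda>w. \<Sum>i\<in>I. f' i w) (\<lambda>w. \<Sum>i\<in>I. f'' i w) U"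
    unfolding deriv_C_on_def by (auto intro!: has_deriv_C_sum)
  moreover have "deriv_C_on (\<lambda>w. \<Sum>i\<in>I. f i w) (\<lambda>w. \<Sum>i\<in>I. f' i w) U"
    using assms unfolding twice_deriv_C_on_def deriv_C_on_def by (auto intro!: has_deriv_C_sum)
  ultimately show ?thesis unfolding twice_deriv_C_on_def by blast
qed

lemma twice_deriv_C_on_transform:
  assumes "twice_deriv_C_on f f' U" "open U" "\<And>w. w \<in> U \<Longrightarrow> f w = g w"
  shows "twice_deriv_C_on g f' U"
proof -
  have "has_deriv_C g (f' w) w" if "w \<in> U" for w
    by (rule has_deriv_C_transform[OF _ assms(2) that assms(3)])
       (use assms(1) that in \<open>auto simp: twice_deriv_C_on_def deriv_C_on_def\<close>)
  then show ?thesis using assms(1) by (auto simp: twice_deriv_C_on_def deriv_C_on_def)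
qed

text \<open>A holomorphic frame is a holomorphic combination of the power series frame, hence its
  derivative is again (norm) holomorphic.\<close>

lemma local_frame_imp_frame_on:
  fixes T :: "'a::chilbert_space \<Rightarrow> 'a" and \<gamma> :: "'n::finite \<Rightarrow> complex \<Rightarrow> 'a"
  assumes T: "T \<in> cowen_douglas CARD('n) \<Omega>" and \<Omega>: "open \<Omega>" and \<gamma>: "local_frame \<Omega> T z \<gamma>"
  obtains U where "frame_on T \<gamma> U" "z \<in> U" "U \<subseteq> \<Omega>"
proof -
  obtain U where U0: "open U \<and> z \<in> U \<and> U \<subseteq> \<Omega> \<and> (\<forall>i. holomorphic_vec_on (\<gamma> i) U) \<and>
     (\<forall>w\<in>U. inj (\<lambda>i. \<gamma> i w) \<and> complex_vector.independent (range (\<lambda>i. \<gamma> i w)) \<and>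
        complex_vector.span (range (\<lambda>i. \<gamma> i w)) = eigenspace T w)"
    using \<gamma> unfolding local_frame_def ..
  then have U: "open U" "z \<in> U" "U \<subseteq> \<Omega>" "\<And>i. holomorphic_vec_on (\<gamma> i) U"
    "\<And>w. w \<in> U \<Longrightarrow> independent_family (\<lambda>i. \<gamma> i w)"
    "\<And>w. w \<in> U \<Longrightarrow> complex_vector.span (range (\<lambda>i. \<gamma> i w)) = eigenspace T w"
    unfolding independent_family_iff by simp_all
  have "z \<in> \<Omega>" using U(2,3) by (rule subsetD[rotated])
  then obtain \<delta> :: "'n \<Rightarrow> complex \<Rightarrow> 'a" and W where W: "frame_on T \<delta> W" "z \<in> W"
    by (rule exists_frame_on[OF T \<Omega>]) (rule that)
  then have oW: "open W" by (simp add: frame_on_def)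
  obtain \<delta>' where \<delta>': "\<And>i. twice_deriv_C_on (\<delta> i) (\<delta>' i) W"
    using W(1) unfolding frame_on_def by metis
  have oUW: "open (U \<inter> W)" "z \<in> U \<inter> W" using U W(2) oW by auto
  have sub: "deriv_C_on f f' (U \<inter> W)" if "deriv_C_on f f' U \<or> deriv_C_on f f' W" for f f' :: "complex \<Rightarrow> 'a"
    using that deriv_C_on_subset by blast
  have hol: "holomorphic_vec_on (\<gamma> i) (U \<inter> W)" "holomorphic_vec_on (\<delta> i) (U \<inter> W)" for i
    using U(4)[of i] \<delta>'[of i] sub oUW(1) holomorphic_vec_on_iff[OF U(1)]
    unfolding holomorphic_vec_on_iff[OF oUW(1)] twice_deriv_C_on_def by blast+
  have ind: "independent_family (\<lambda>i. \<delta> i z)" using W by (simp add: frame_on_def)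
  have span: "\<gamma> i w \<in> complex_vector.span (range (\<lambda>i. \<delta> i w))" if "w \<in> U \<inter> W" for i w
  proof -
    have "\<gamma> i w \<in> complex_vector.span (range (\<lambda>i. \<gamma> i w))"
      by (rule complex_vector.span_base) simp
    then show ?thesis using that W(1) U(6) by (simp add: frame_on_def)
  qed
  obtain V and a :: "complex \<Rightarrow> complex^'n^'n" where V: "open V" "z \<in> V" "V \<subseteq> U \<inter> W"
    "\<And>i j. (\<lambda>w. a w $ i $ j) holomorphic_on V"
    "\<And>w j. w \<in> V \<Longrightarrow> \<gamma> j w = (\<Sum>k\<in>UNIV. a w $ k $ j *\<^sub>C \<delta> k w)"
    by (rule transition_matrix[OF oUW hol ind span]) (assumption | rule that)+
  have "twice_deriv_C_on (\<delta> i) (\<delta>' i) V" for i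
    using \<delta>'[of i] V(3) unfolding twice_deriv_C_on_def by (auto intro: deriv_C_on_subset[of _ _ W V])
  then have "twice_deriv_C_on (\<lambda>w. \<Sum>k\<in>UNIV. a w $ k $ j *\<^sub>C \<delta> k w)
      (\<lambda>w. \<Sum>k\<in>UNIV. deriv (\<lambda>w. a w $ k $ j) w *\<^sub>C \<delta> k w + a w $ k $ j *\<^sub>C \<delta>' k w) V" for j
    by (intro twice_deriv_C_on_sum twice_deriv_C_on_scaleC V)
  then have "\<exists>\<gamma>'. twice_deriv_C_on (\<gamma> j) \<gamma>' V" for j
    by (intro exI, rule twice_deriv_C_on_transform[OF _ V(1)]) (simp add: V(5))
  then have "frame_on T \<gamma> V"
    using V(1,3) U(5,6) by (auto simp: frame_on_def subset_iff)
  then show ?thesis using that V U(3) by blast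
qed

lemma exists_local_frame:
  fixes T :: "'a::chilbert_space \<Rightarrow> 'a"
  assumes "T \<in> cowen_douglas CARD('n::finite) \<Omega>" "open \<Omega>" "z \<in> \<Omega>"
  shows "\<exists>\<gamma> :: 'n \<Rightarrow> complex \<Rightarrow> 'a. local_frame \<Omega> T z \<gamma>"
proof -
  obtain \<gamma> :: "'n \<Rightarrow> complex \<Rightarrow> 'a" and U where \<gamma>: "frame_on T \<gamma> U" "z \<in> U" "U \<subseteq> \<Omega>"
    using exists_frame_on[OF assms] .
  have "open U" using \<gamma>(1) by (simp add: frame_on_def)
  have "holomorphic_vec_on (\<gamma> i) U" for i
    using \<gamma>(1) unfolding holomorphic_vec_on_iff[OF \<open>open U\<close>] frame_on_def twice_deriv_C_on_def by blast
  then have "local_frame \<Omega> T z \<gamma>"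
    using \<gamma> unfolding local_frame_def frame_on_def independent_family_iff
    by (intro exI[of _ U]) simp
  then show ?thesis by (intro exI)
qed

lemma mat_has_wirtinger_cross_gram:
  assumes "\<And>i. deriv_C_on (x i) (x' i) U" "\<And>i. deriv_C_on (y i) (y' i) U" "w \<in> U"
  shows "mat_has_wirtinger (\<lambda>w. cross_gram (\<lambda>i. x i w) (\<lambda>i. y i w))
     (cross_gram (\<lambda>i. x i w) (\<lambda>i. y' i w)) (cross_gram (\<lambda>i. x' i w) (\<lambda>i. y i w)) w"
  using assms unfolding mat_has_wirtinger_def cross_gram_def deriv_C_on_def
  by (auto intro!: has_wirtinger_cinner)

lemma frame_on_imp_regular_metric:
  assumes "frame_on T \<gamma> U"
  shows "regular_metric_on (gram \<gamma>) U"
proof -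
  have U: "open U" using assms by (simp add: frame_on_def)
  obtain \<gamma>' \<gamma>'' where \<gamma>: "\<And>i. deriv_C_on (\<gamma> i) (\<gamma>' i) U" "\<And>i. deriv_C_on (\<gamma>' i) (\<gamma>'' i) U"
    using assms unfolding frame_on_def twice_deriv_C_on_def by metis
  let ?G = "\<lambda>x y w. cross_gram (\<lambda>i. x i w) (\<lambda>i. y i w)"
  have g: "gram \<gamma> = ?G \<gamma> \<gamma>" by (simp add: gram_eq_cross_gram fun_eq_iff)
  have det: "det (gram \<gamma> w) \<noteq> 0" if "w \<in> U" for w
    using assms that det_cross_gram_self unfolding g frame_on_def by blast
  note D = mat_has_wirtinger_cross_gram[of \<gamma> \<gamma>' U \<gamma> \<gamma>', OF \<gamma>(1) \<gamma>(1), folded g]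
  note D01 = mat_has_wirtinger_cross_gram[of \<gamma> \<gamma>' U \<gamma>' \<gamma>'', OF \<gamma>(1) \<gamma>(2)]
  note D10 = mat_has_wirtinger_cross_gram[of \<gamma>' \<gamma>'' U \<gamma> \<gamma>', OF \<gamma>(2) \<gamma>(1)]
  note D11 = mat_has_wirtinger_cross_gram[of \<gamma>' \<gamma>'' U \<gamma>' \<gamma>'', OF \<gamma>(2) \<gamma>(2)]
  note DI = mat_has_wirtinger_inv[OF D U _ det]
  have d: "matrix_d (gram \<gamma>) w = ?G \<gamma> \<gamma>' w" if "w \<in> U" for w
    using mat_has_wirtinger_imp(1)[OF D[OF that]] .
  have conn: "mat_has_wirtinger (\<lambda>w. matrix_inv (gram \<gamma> w) ** matrix_d (gram \<gamma>) w)
    (- (matrix_inv (gram \<gamma> w) ** ?G \<gamma> \<gamma>' w ** matrix_inv (gram \<gamma> w)) ** ?G \<gamma> \<gamma>' w + matrix_inv (gram \<gamma> w) ** ?G \<gamma> \<gamma>'' w)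
    (- (matrix_inv (gram \<gamma> w) ** ?G \<gamma>' \<gamma> w ** matrix_inv (gram \<gamma> w)) ** ?G \<gamma> \<gamma>' w + matrix_inv (gram \<gamma> w) ** ?G \<gamma>' \<gamma>' w) w"
    if "w \<in> U" for w
    by (rule mat_has_wirtinger_transform[OF mat_has_wirtinger_mult[OF DI[OF that that] D01[OF that]] U that])
       (simp_all add: d)
  have curv: "metric_curvature (gram \<gamma>) w =
     mat (-1) ** (matrix_inv (gram \<gamma> w) ** ?G \<gamma>' \<gamma> w ** matrix_inv (gram \<gamma> w)) ** ?G \<gamma> \<gamma>' w + matrix_inv (gram \<gamma> w) ** ?G \<gamma>' \<gamma>' w"
    if "w \<in> U" for w
  proof -
    have "mat (-1) ** X = - X" for X :: "complex^'b^'b"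
      by (simp add: vec_eq_iff matrix_matrix_mult_def mat_def if_distrib[of "\<lambda>x. x * _"] cong: if_cong)
    then show ?thesis
      unfolding metric_curvature_def mat_has_wirtinger_imp(2)[OF conn[OF that]] by simp
  qed
  show ?thesis
    unfolding regular_metric_on_def
  proof (intro conjI ballI)
    fix w assume w: "w \<in> U"
    show "det (gram \<gamma> w) \<noteq> 0" by (rule det[OF w])
    show "mat_wirtinger_differentiable (gram \<gamma>) w"
      by (rule mat_wirtinger_differentiableI[OF D[OF w]])
    show "mat_wirtinger_differentiable (matrix_d (gram \<gamma>)) w"
      by (rule mat_wirtinger_differentiableI[OF mat_has_wirtinger_transform[OF D01[OF w] U w d[symmetric]]])
    show "mat_wirtinger_differentiable (metric_curvature (gram \<gamma>)) w"
      by (rule mat_wirtinger_differentiableI[OF mat_has_wirtinger_transform[OF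
         mat_has_wirtinger_add[OF mat_has_wirtinger_mult[OF mat_has_wirtinger_mult[OF mat_has_wirtinger_const
           mat_has_wirtinger_mult[OF mat_has_wirtinger_mult[OF DI[OF w w] D10[OF w]] DI[OF w w]]] D01[OF w]]
           mat_has_wirtinger_mult[OF DI[OF w w] D11[OF w]]] U w curv[symmetric]]])
  qed (rule U)
qed

section \<open>Homogeneous operators\<close>

lemma functional_calculus_eigenvector:
  assumes fc: "is_functional_calculus f T S" and T: "bounded_clinear T"
    and f: "f holomorphic_on ball 0 1" and w: "w \<in> ball 0 1" and x: "x \<in> eigenspace T w"
  shows "S x = f w *\<^sub>C x"
proof -
  define c where "c k = (deriv ^^ k) f 0 / fact k" for k
  let ?R = "\<lambda>N x. (\<Sum>k<N. c k *\<^sub>C (T ^^ k) x) - S x"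
  have Tlin: "bounded_linear T" and Tsc: "\<And>c x. T (c *\<^sub>C x) = c *\<^sub>C T x"
    using T by (auto simp: bounded_clinear_def)
  have "bounded_linear S" using fc by (simp add: is_functional_calculus_def bounded_clinear_def)
  have pow: "bounded_linear (T ^^ k)" for k
    by (induction k) (auto simp: id_def comp_def intro!: bounded_linear_compose[OF Tlin])
  have bl: "bounded_linear (?R N)" for N
    by (intro bounded_linear_sub bounded_linear_sum \<open>bounded_linear S\<close>
        bounded_linear_compose[OF bounded_linear_scaleC_right pow])
  have "T x = w *\<^sub>C x" using x by (simp add: eigenspace_def shift_def)
  then have Tk: "(T ^^ k) x = w ^ k *\<^sub>C x" for k
    by (induction k) (auto simp: scaleC_one Tsc scaleC_scaleC mult.commute)
  have "(\<lambda>N. onorm (?R N) * norm x) \<longlonglongrightarrow> 0"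
    using fc by (intro tendsto_mult_left_zero) (simp add: is_functional_calculus_def c_def)
  then have "(\<lambda>N. ?R N x) \<longlonglongrightarrow> 0"
    by (rule Lim_null_comparison[rotated]) (simp add: onorm[OF bl])
  then have 1: "(\<lambda>N. (\<Sum>k<N. c k * w ^ k) *\<^sub>C x) \<longlonglongrightarrow> S x"
    by (simp add: Tk scaleC_scaleC complex_vector.scale_sum_left LIM_zero_iff)
  have "(\<lambda>N. \<Sum>k<N. c k * w ^ k) \<longlonglongrightarrow> f w"
    using holomorphic_power_series[OF f w] by (simp add: sums_def c_def)
  then have "(\<lambda>N. (\<Sum>k<N. c k * w ^ k) *\<^sub>C x) \<longlonglongrightarrow> f w *\<^sub>C x"
    by (rule bounded_linear.tendsto[OF bounded_bilinear.bounded_linear_left[OF bounded_bilinear_scaleC]])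
  with 1 show ?thesis by (rule LIMSEQ_unique)
qed

lemma homogeneous_intertwiner:
  fixes T :: "'a::chilbert_space \<Rightarrow> 'a"
  assumes T: "homogeneous T" and \<phi>: "disc_automorphism \<phi>"
  obtains V where "unitary_between UNIV UNIV V"
    "\<And>w x. w \<in> ball 0 1 \<Longrightarrow> x \<in> eigenspace T w \<Longrightarrow> V x \<in> eigenspace T (\<phi> w)"
proof -
  have "\<exists>S. is_functional_calculus \<phi> T S \<and> unitarily_equivalent S T"
    using assms unfolding homogeneous_def by (elim conjE allE[of _ \<phi>]) simp
  then obtain S V where S: "is_functional_calculus \<phi> T S"
    and V: "unitary_between UNIV UNIV V" "\<And>x. V (S x) = T (V x)"
    unfolding unitarily_equivalent_def by metis
  have "V x \<in> eigenspace T (\<phi> w)" if "w \<in> ball 0 1" "x \<in> eigenspace T w" for w x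
  proof -
    have "S x = \<phi> w *\<^sub>C x"
      using functional_calculus_eigenvector[OF S _ _ that] T \<phi>
      by (simp add: homogeneous_def disc_automorphism_def)
    then have "T (V x) = \<phi> w *\<^sub>C V x"
      using V by (metis UNIV_I unitary_between_def)
    then show ?thesis by (simp add: eigenspace_def shift_def)
  qed
  then show ?thesis by (rule that[OF V(1)])
qed

lemma unitary_bounded_linear:
  assumes "unitary_between UNIV UNIV V"
  shows "bounded_linear V"
proof (rule bounded_linear_intro)
  fix x y r
  show "V (x + y) = V x + V y" "V (r *\<^sub>R x) = r *\<^sub>R V x"
    using assms unfolding unitary_between_def scaleR_scaleC by blast+
  have "complex_of_real ((norm (V x))\<^sup>2) = complex_of_real ((norm x)\<^sup>2)"
    using assms unfolding unitary_between_def cinner_self[symmetric] by blast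
  then have "(norm (V x))\<^sup>2 = (norm x)\<^sup>2" using of_real_eq_iff by blast
  then show "norm (V x) \<le> norm x * 1" by simp
qed

lemma unitary_between_sum:
  assumes "unitary_between UNIV UNIV V"
  shows "V (\<Sum>i\<in>I. c i *\<^sub>C f i) = (\<Sum>i\<in>I. c i *\<^sub>C V (f i))"
proof -
  have "V (\<Sum>i\<in>I. c i *\<^sub>C f i) = (\<Sum>i\<in>I. V (c i *\<^sub>C f i))"
    using unitary_bounded_linear[OF assms] by (intro linear_sum) (rule bounded_linear.linear)
  then show ?thesis using assms unfolding unitary_between_def by simp
qed

lemma deriv_C_on_unitary:
  assumes "unitary_between UNIV UNIV V" "deriv_C_on f f' U"
  shows "deriv_C_on (\<lambda>w. V (f w)) (\<lambda>w. V (f' w)) U"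
  unfolding deriv_C_on_def has_deriv_C_def
proof
  fix z assume "z \<in> U"
  then have "(f has_derivative (\<lambda>h. h *\<^sub>C f' z)) (at z)"
    using assms(2) by (simp add: deriv_C_on_def has_deriv_C_def)
  from bounded_linear.has_derivative[OF unitary_bounded_linear[OF assms(1)] this]
  show "((\<lambda>w. V (f w)) has_derivative (\<lambda>h. h *\<^sub>C V (f' z))) (at z)"
    using assms(1) by (simp add: unitary_between_def)
qed

lemma frame_operator_sum:
  assumes "independent_family (\<lambda>i. \<gamma> i z)"
  shows "frame_operator \<gamma> z M (\<Sum>j\<in>UNIV. c $ j *\<^sub>C \<gamma> j z) = (\<Sum>i\<in>UNIV. (M *v c) $ i *\<^sub>C \<gamma> i z)"
proof -
  let ?B = "range (\<lambda>k. \<gamma> k z)"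
  have ind: "complex_vector.independent ?B" and inj: "inj (\<lambda>k. \<gamma> k z)"
    using assms by (auto simp: independent_family_iff)
  have "complex_vector.representation ?B (\<Sum>j\<in>UNIV. c $ j *\<^sub>C \<gamma> j z) (\<gamma> i z) = c $ i" for i
  proof -
    have "complex_vector.representation ?B (\<Sum>j\<in>UNIV. c $ j *\<^sub>C \<gamma> j z) (\<gamma> i z) =
      (\<Sum>j\<in>UNIV. complex_vector.representation ?B (c $ j *\<^sub>C \<gamma> j z) (\<gamma> i z))"
      by (subst complex_vector.representation_sum[OF ind])
         (auto intro: complex_vector.span_scale complex_vector.span_base)
    also have "\<dots> = (\<Sum>j\<in>UNIV. c $ j * (if i = j then 1 else 0))"
    proof (rule sum.cong[OF refl])
      fix j
      have "complex_vector.representation ?B (c $ j *\<^sub>C \<gamma> j z) (\<gamma> i z) =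
        c $ j * complex_vector.representation ?B (\<gamma> j z) (\<gamma> i z)"
        by (subst complex_vector.representation_scale[OF ind])
           (auto intro: complex_vector.span_base)
      moreover have "\<gamma> i z = \<gamma> j z \<longleftrightarrow> i = j" using inj by (auto dest: injD)
      ultimately show "complex_vector.representation ?B (c $ j *\<^sub>C \<gamma> j z) (\<gamma> i z) = c $ j * (if i = j then 1 else 0)"
        by (simp add: complex_vector.representation_basis[OF ind])
    qed
    finally show ?thesis by (simp add: if_distrib[of "\<lambda>x. _ * x"] cong: if_cong)
  qed
  then show ?thesis
    unfolding frame_operator_def
    by (simp add: matrix_vector_mult_def complex_vector.scale_sum_left)
qed

lemma frame_operator_intertwine:
  assumes V: "unitary_between UNIV UNIV V"
    and \<gamma>: "independent_family (\<lambda>i. \<gamma> i z)" and \<delta>: "independent_family (\<lambda>i. \<delta> i z')"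
    and a: "\<And>j. V (\<gamma> j z) = (\<Sum>k\<in>UNIV. a $ k $ j *\<^sub>C \<delta> k z')"
    and MN: "a ** M = N ** a"
    and x: "x \<in> complex_vector.span (range (\<lambda>i. \<gamma> i z))"
  shows "V (frame_operator \<gamma> z M x) = frame_operator \<delta> z' N (V x)"
proof -
  have Vsum: "V (\<Sum>j\<in>UNIV. c $ j *\<^sub>C \<gamma> j z) = (\<Sum>k\<in>UNIV. (a *v c) $ k *\<^sub>C \<delta> k z')" for c
  proof -
    have "V (\<Sum>j\<in>UNIV. c $ j *\<^sub>C \<gamma> j z) = (\<Sum>j\<in>UNIV. \<Sum>k\<in>UNIV. (a $ k $ j * c $ j) *\<^sub>C \<delta> k z')"
      unfolding unitary_between_sum[OF V] a
      by (simp add: complex_vector.scale_sum_right scaleC_scaleC mult.commute)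
    also have "\<dots> = (\<Sum>k\<in>UNIV. \<Sum>j\<in>UNIV. (a $ k $ j * c $ j) *\<^sub>C \<delta> k z')"
      by (rule sum.swap)
    finally show ?thesis
      by (simp add: matrix_vector_mult_def complex_vector.scale_sum_left)
  qed
  obtain c0 where "x = (\<Sum>j\<in>UNIV. c0 j *\<^sub>C \<gamma> j z)"
    using span_range_family[OF x] .
  then have x: "x = (\<Sum>j\<in>UNIV. (\<chi> j. c0 j) $ j *\<^sub>C \<gamma> j z)" by simp
  show ?thesis
    unfolding x frame_operator_sum[of \<gamma> z, OF \<gamma>] Vsum frame_operator_sum[of \<delta> z', OF \<delta>]
    by (simp add: matrix_vector_mul_assoc MN)
qed

lemma frame_operator_mat:
  "frame_operator \<gamma> z (M ** mat c) x = c *\<^sub>C frame_operator \<gamma> z M x"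
proof -
  have "(M ** mat c) $ i $ j = c * M $ i $ j" for i j
    by (simp add: matrix_matrix_mult_def mat_def if_distrib[of "\<lambda>x. _ * x"] cong: if_cong)
  then show ?thesis
    by (simp add: frame_operator_def complex_vector.scale_sum_right scaleC_scaleC mult.assoc)
qed

lemma frame_operator_add:
  "frame_operator \<gamma> z (M + N) x = frame_operator \<gamma> z M x + frame_operator \<gamma> z N x"
  by (simp add: frame_operator_def distrib_right scaleC_add_left sum.distrib)

lemma frame_operator_in_span:
  "frame_operator \<gamma> z M x \<in> complex_vector.span (range (\<lambda>i. \<gamma> i z))"
  unfolding frame_operator_def
  by (intro complex_vector.span_sum complex_vector.span_scale complex_vector.span_base) auto

lemma curvature_matrix_eq: "curvature_matrix \<gamma> = metric_curvature (gram \<gamma>)"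
  by (simp add: curvature_matrix_def metric_curvature_def)

lemma disc_automorphism_Moebius:
  assumes "z \<in> ball 0 1"
  shows "disc_automorphism (Moebius_function 0 (- z))" "Moebius_function 0 (- z) 0 = z"
proof -
  let ?f = "Moebius_function 0 (- z)" and ?g = "Moebius_function 0 z"
  have z: "cmod z < 1" using assms by simp
  have gf: "?g (?f w) = w" if "w \<in> ball 0 1" for w
    using Moebius_function_compose[of z "-z" w] z that by simp
  have fg: "?f (?g w) = w" if "w \<in> ball 0 1" for w
    using Moebius_function_compose[of "-z" z w] z that by simp
  have fB: "?f w \<in> ball 0 1" and gB: "?g w \<in> ball 0 1" if "w \<in> ball 0 1" for w
    using Moebius_function_norm_lt_1 z that by auto
  have bij: "bij_betw ?f (ball 0 1) (ball 0 1)"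
    by (rule bij_betwI[of _ _ _ ?g]) (use fB gB fg gf in auto)
  have "inv_into (ball 0 1) ?f w = ?g w" if "w \<in> ball 0 1" for w
    using bij_betw_imp_inj_on[OF bij] gB[OF that] fg[OF that] by (intro inv_into_f_eq)
  moreover have "?g holomorphic_on ball 0 1" by (rule Moebius_function_holomorphic[OF z])
  ultimately have "inv_into (ball 0 1) ?f holomorphic_on ball 0 1"
    by (metis (no_types, lifting) holomorphic_transform)
  then show "disc_automorphism ?f"
    using bij Moebius_function_holomorphic[of "-z"] z by (simp add: disc_automorphism_def)
  show "?f 0 = z" by (simp add: Moebius_function_of_zero)
qed

lemma curvature_transport:
  fixes T :: "'a::chilbert_space \<Rightarrow> 'a"
  assumes T: "T \<in> cowen_douglas CARD('n::finite) (ball 0 1)" "homogeneous T"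
    and \<phi>: "disc_automorphism \<phi>"
  defines "K \<equiv> curvature TYPE('n) (ball 0 1) T" and "L \<equiv> curvature_dbar TYPE('n) (ball 0 1) T"
    and "d \<equiv> deriv \<phi> 0" and "e \<equiv> deriv (deriv \<phi>) 0"
  obtains V where "unitary_between (eigenspace T 0) (eigenspace T (\<phi> 0)) V"
    "\<And>x. x \<in> eigenspace T 0 \<Longrightarrow> V (K 0 x) = (cnj d * d) *\<^sub>C K (\<phi> 0) (V x)"
    "\<And>x. x \<in> eigenspace T 0 \<Longrightarrow> V (L 0 x) = ((cnj d)\<^sup>2 * d) *\<^sub>C L (\<phi> 0) (V x) + (cnj e * d) *\<^sub>C K (\<phi> 0) (V x)"
proof -
  let ?B = "ball 0 1 :: complex set"
  have hol: "\<phi> holomorphic_on ?B" and \<phi>B: "\<And>w. w \<in> ?B \<Longrightarrow> \<phi> w \<in> ?B"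
    using \<phi> by (auto simp: disc_automorphism_def bij_betw_def)
  have 0: "0 \<in> ?B" "\<phi> 0 \<in> ?B" using \<phi>B[of 0] by simp_all
  define \<gamma> where "\<gamma> = (SOME \<gamma> :: 'n \<Rightarrow> complex \<Rightarrow> 'a. local_frame ?B T 0 \<gamma>)"
  define \<delta> where "\<delta> = (SOME \<gamma> :: 'n \<Rightarrow> complex \<Rightarrow> 'a. local_frame ?B T (\<phi> 0) \<gamma>)"
  have \<gamma>: "local_frame ?B T 0 \<gamma>"
    unfolding \<gamma>_def by (rule someI_ex[OF exists_local_frame[OF T(1) open_ball 0(1)]])
  have \<delta>: "local_frame ?B T (\<phi> 0) \<delta>"
    unfolding \<delta>_def by (rule someI_ex[OF exists_local_frame[OF T(1) open_ball 0(2)]])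
  obtain G where G: "frame_on T \<gamma> G" "0 \<in> G"
    by (rule local_frame_imp_frame_on[OF T(1) open_ball \<gamma>]) (rule that)
  obtain D where D: "frame_on T \<delta> D" "\<phi> 0 \<in> D"
    by (rule local_frame_imp_frame_on[OF T(1) open_ball \<delta>]) (rule that)
  have op: "open G" "open D" using G(1) D(1) by (simp_all add: frame_on_def)
  have Geig: "complex_vector.span (range (\<lambda>i. \<gamma> i w)) = eigenspace T w"
    "independent_family (\<lambda>i. \<gamma> i w)" if "w \<in> G" for w
    using G(1) that by (simp_all add: frame_on_def)
  have Deig: "complex_vector.span (range (\<lambda>i. \<delta> i w)) = eigenspace T w"
    "independent_family (\<lambda>i. \<delta> i w)" if "w \<in> D" for w
    using D(1) that by (simp_all add: frame_on_def)
  obtain V where V: "unitary_between UNIV UNIV V"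
    "\<And>w x. w \<in> ?B \<Longrightarrow> x \<in> eigenspace T w \<Longrightarrow> V x \<in> eigenspace T (\<phi> w)"
    by (rule homogeneous_intertwiner[OF T(2) \<phi>]) (rule that)
  define W where "W = G \<inter> (?B \<inter> \<phi> -` D)"
  have W: "open W" "0 \<in> W"
    using op continuous_open_preimage[OF holomorphic_on_imp_continuous_on[OF hol] open_ball op(2)]
      G(2) D(2) by (auto simp: W_def)
  have WD: "w \<in> G" "w \<in> ?B" "\<phi> w \<in> D" if "w \<in> W" for w
    using that by (auto simp: W_def)
  have holV: "holomorphic_vec_on (\<lambda>w. V (\<gamma> i w)) W" for i
  proof -
    obtain \<gamma>' where "deriv_C_on (\<gamma> i) \<gamma>' G"
      using G(1) unfolding frame_on_def twice_deriv_C_on_def by metis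
    then have "deriv_C_on (\<gamma> i) \<gamma>' W" by (rule deriv_C_on_subset) (simp add: W_def)
    from deriv_C_on_unitary[OF V(1) this] show ?thesis
      unfolding holomorphic_vec_on_iff[OF W(1)] by (intro exI)
  qed
  have hol\<delta>: "holomorphic_vec_on (\<lambda>w. \<delta> i (\<phi> w)) W" for i
  proof -
    obtain \<delta>' where \<delta>': "deriv_C_on (\<delta> i) \<delta>' D"
      using D(1) unfolding frame_on_def twice_deriv_C_on_def by metis
    have "has_deriv_C (\<lambda>w. \<delta> i (\<phi> w)) (deriv \<phi> w *\<^sub>C \<delta>' (\<phi> w)) w" if "w \<in> W" for w
      using \<delta>' WD[OF that] by (intro has_deriv_C_compose holomorphic_derivI[OF hol open_ball])
        (auto simp: deriv_C_on_def)
    then have "deriv_C_on (\<lambda>w. \<delta> i (\<phi> w)) (\<lambda>w. deriv \<phi> w *\<^sub>C \<delta>' (\<phi> w)) W"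
      by (simp add: deriv_C_on_def)
    then show ?thesis unfolding holomorphic_vec_on_iff[OF W(1)] by (intro exI)
  qed
  have V\<gamma>: "V (\<gamma> i w) \<in> eigenspace T (\<phi> w)" if "w \<in> W" for w i
  proof (rule V(2))
    show "w \<in> ?B" by (rule WD(2)[OF that])
    show "\<gamma> i w \<in> eigenspace T w"
      unfolding Geig(1)[OF WD(1)[OF that], symmetric] by (rule complex_vector.span_base) simp
  qed
  have span: "V (\<gamma> i w) \<in> complex_vector.span (range (\<lambda>i. \<delta> i (\<phi> w)))" if "w \<in> W" for w i
    unfolding Deig(1)[OF WD(3)[OF that]] by (rule V\<gamma>[OF that])
  obtain X and a :: "complex \<Rightarrow> complex^'n^'n" where X: "open X" "0 \<in> X" "X \<subseteq> W"
    and a: "\<And>i j. (\<lambda>w. a w $ i $ j) holomorphic_on X"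
    "\<And>w j. w \<in> X \<Longrightarrow> V (\<gamma> j w) = (\<Sum>k\<in>UNIV. a w $ k $ j *\<^sub>C \<delta> k (\<phi> w))"
    by (rule transition_matrix[of W 0 "\<lambda>i w. V (\<gamma> i w)" "\<lambda>i w. \<delta> i (\<phi> w)", OF W holV hol\<delta> Deig(2)[OF D(2)] span])
      (assumption | rule that)+
  have gram: "gram \<gamma> w = adjoint_matrix (a w) ** gram \<delta> (\<phi> w) ** a w" if "w \<in> X" for w
  proof -
    have "gram \<gamma> w = cross_gram (\<lambda>i. V (\<gamma> i w)) (\<lambda>i. V (\<gamma> i w))"
      using V(1) by (simp add: gram_eq_cross_gram cross_gram_def unitary_between_def)
    then show ?thesis
      using gram_transition[of "\<lambda>j. V (\<gamma> j w)" "a w" "\<lambda>k. \<delta> k (\<phi> w)", OF a(2)[OF that]]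
      by (simp add: gram_eq_cross_gram)
  qed
  have det: "det (a w) \<noteq> 0" if "w \<in> X" for w
  proof -
    have "det (gram \<gamma> w) \<noteq> 0"
      using that X(3) WD(1) det_cross_gram_self[OF Geig(2)] by (auto simp: gram_eq_cross_gram)
    then show ?thesis using gram[OF that] by (simp add: det_mul)
  qed
  have "X \<subseteq> ?B" "\<phi> ` X \<subseteq> D" using X(3) WD by auto
  note pull = metric_curvature_pullback[OF frame_on_imp_regular_metric[OF D(1)] X(1)
      holomorphic_on_subset[OF hol this(1)] this(2) a(1) det gram X(2)]
  note inter = frame_operator_intertwine[of V \<gamma> 0 \<delta> "\<phi> 0" "a 0", OF V(1) Geig(2)[OF G(2)] Deig(2)[OF D(2)] a(2)[OF X(2)],
      unfolded Geig(1)[OF G(2)]]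
  show ?thesis
  proof (rule that)
    show "V (K 0 x) = (cnj d * d) *\<^sub>C K (\<phi> 0) (V x)" if "x \<in> eigenspace T 0" for x
      using inter[OF pull(1) that]
      by (simp add: K_def d_def curvature_def Let_def curvature_matrix_eq frame_operator_mat
          flip: \<gamma>_def \<delta>_def)
    show "V (L 0 x) = ((cnj d)\<^sup>2 * d) *\<^sub>C L (\<phi> 0) (V x) + (cnj e * d) *\<^sub>C K (\<phi> 0) (V x)"
      if "x \<in> eigenspace T 0" for x
      using inter[OF pull(2) that]
      by (simp add: K_def L_def d_def e_def curvature_def curvature_dbar_def Let_def
          curvature_matrix_eq frame_operator_mat frame_operator_add flip: \<gamma>_def \<delta>_def)
    show "unitary_between (eigenspace T 0) (eigenspace T (\<phi> 0)) V"
      unfolding unitary_between_def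
    proof (intro conjI)
      show "V ` eigenspace T 0 = eigenspace T (\<phi> 0)"
      proof
        show "V ` eigenspace T 0 \<subseteq> eigenspace T (\<phi> 0)" using V(2)[OF 0(1)] by blast
        have "independent_family (\<lambda>i. V (\<gamma> i 0))"
          using gram[OF X(2)] det_cross_gram_self[OF Geig(2)[OF G(2)]] V(1)
          by (intro det_cross_gram_imp_independent[of "\<lambda>i. V (\<gamma> i 0)"])
            (simp add: cross_gram_def unitary_between_def)
        moreover have "complex_vector.dim (eigenspace T (\<phi> 0)) = CARD('n)" "bounded_clinear T"
          using T(1) 0(2) by (auto simp: cowen_douglas_def)
        ultimately have "complex_vector.span (range (\<lambda>i. V (\<gamma> i 0))) = eigenspace T (\<phi> 0)"
          using V\<gamma>[OF W(2)] by (intro independent_family_spans subspace_eigenspace)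
        moreover have "y \<in> V ` eigenspace T 0"
          if y: "y \<in> complex_vector.span (range (\<lambda>i. V (\<gamma> i 0)))" for y
        proof -
          obtain c where "y = (\<Sum>j\<in>UNIV. c j *\<^sub>C V (\<gamma> j 0))" using span_range_family[OF y] .
          then have "y = V (\<Sum>j\<in>UNIV. c j *\<^sub>C \<gamma> j 0)" by (simp add: unitary_between_sum[OF V(1)])
          moreover have "(\<Sum>j\<in>UNIV. c j *\<^sub>C \<gamma> j 0) \<in> eigenspace T 0"
            unfolding Geig(1)[OF G(2), symmetric] by (rule sum_scaleC_in_span)
          ultimately show ?thesis by (rule image_eqI)
        qed
        ultimately show "eigenspace T (\<phi> 0) \<subseteq> V ` eigenspace T 0" by blast
      qed
    qed (use V(1) in \<open>auto simp: unitary_between_def\<close>)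
  qed
qed

lemma unitary_between_inj_on:
  assumes "unitary_between E F U" "complex_vector.subspace E"
  shows "inj_on U E"
proof (rule inj_onI)
  fix x y assume xy: "x \<in> E" "y \<in> E" "U x = U y"
  let ?d = "x + (-1) *\<^sub>C y"
  have m: "(-1) *\<^sub>C y \<in> E" using assms(2) xy(2) by (rule complex_vector.subspace_scale)
  then have d: "?d \<in> E" using complex_vector.subspace_add[OF assms(2) xy(1)] by blast
  have "U ((-1) *\<^sub>C y) = (-1) *\<^sub>C U y"
    using assms(1) xy(2) unfolding unitary_between_def by blast
  moreover have "U ?d = U x + U ((-1) *\<^sub>C y)"
    using assms(1) xy(1) m unfolding unitary_between_def by blast
  ultimately have "U ?d = 0" by (simp add: xy(3) complex_vector.scale_minus_left scaleC_one)
  then have "cinner ?d ?d = 0"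
    using assms(1) d unfolding unitary_between_def by (metis cinner_zero(1))
  then show "x = y" by (simp add: cinner_self complex_vector.scale_minus_left scaleC_one)
qed

lemma unitary_between_inv_into:
  assumes U: "unitary_between E F U" and E: "complex_vector.subspace E"
  shows "unitary_between F E (inv_into E U)"
proof -
  have inj: "inj_on U E" by (rule unitary_between_inj_on[OF assms])
  have UE: "U ` E = F" using U by (simp add: unitary_between_def)
  have I: "inv_into E U y \<in> E" "U (inv_into E U y) = y" if "y \<in> F" for y
    using that UE inv_into_into[of y U E] f_inv_into_f[of y U E] by auto
  have eq: "inv_into E U y = x" if "x \<in> E" "U x = y" for x y
    using inv_into_f_eq[OF inj that] .
  show ?thesis
    unfolding unitary_between_def
  proof (intro conjI ballI allI)
    fix x y assume "x \<in> F" "y \<in> F"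
    note x = I[OF this(1)] and y = I[OF this(2)]
    show "inv_into E U (x + y) = inv_into E U x + inv_into E U y"
      using U x y complex_vector.subspace_add[OF E] by (intro eq) (auto simp: unitary_between_def)
    have "cinner (U (inv_into E U x)) (U (inv_into E U y)) = cinner (inv_into E U x) (inv_into E U y)"
      using U x(1) y(1) unfolding unitary_between_def by blast
    then show "cinner (inv_into E U x) (inv_into E U y) = cinner x y" using x(2) y(2) by simp
  next
    fix c x assume "x \<in> F"
    note x = I[OF this]
    show "inv_into E U (c *\<^sub>C x) = c *\<^sub>C inv_into E U x"
      using U x complex_vector.subspace_scale[OF E] by (intro eq) (auto simp: unitary_between_def)
  next
    show "inv_into E U ` F = E"
      using inv_into_image_cancel[OF inj, of E] UE by simp
  qed
qed

lemma unitary_between_compose: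
  assumes "unitary_between E F U" "unitary_between F G V"
  shows "unitary_between E G (V \<circ> U)"
proof -
  have "U x \<in> F" if "x \<in> E" for x using assms(1) that by (auto simp: unitary_between_def)
  moreover have "(V \<circ> U) ` E = G"
    unfolding image_comp[symmetric] using assms by (simp add: unitary_between_def)
  ultimately show ?thesis
    using assms unfolding unitary_between_def by simp
qed

lemma simultaneously_unitarily_equivalent_transport:
  fixes E E' :: "'a::chilbert_space set" and F F' :: "'b::chilbert_space set"
  assumes eq: "simultaneously_unitarily_equivalent E A B F C D"
    and E: "complex_vector.subspace E" "\<And>x. x \<in> E \<Longrightarrow> A x \<in> E" "\<And>x. x \<in> E \<Longrightarrow> B x \<in> E"
    and U: "unitary_between E E' U" and V: "unitary_between F F' V"
    and A: "\<And>x. x \<in> E \<Longrightarrow> U (A x) = p *\<^sub>C A' (U x)"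
    and B: "\<And>x. x \<in> E \<Longrightarrow> U (B x) = q *\<^sub>C B' (U x) + r *\<^sub>C A' (U x)"
    and C: "\<And>x. x \<in> F \<Longrightarrow> V (C x) = p *\<^sub>C C' (V x)"
    and D: "\<And>x. x \<in> F \<Longrightarrow> V (D x) = q *\<^sub>C D' (V x) + r *\<^sub>C C' (V x)"
    and pq: "p \<noteq> 0" "q \<noteq> 0"
  shows "simultaneously_unitarily_equivalent E' A' B' F' C' D'"
proof -
  obtain W where W: "unitary_between E F W" "\<And>x. x \<in> E \<Longrightarrow> W (A x) = C (W x)"
    "\<And>x. x \<in> E \<Longrightarrow> W (B x) = D (W x)"
    using eq unfolding simultaneously_unitarily_equivalent_def by blast
  define R where "R = V \<circ> W"
  define Q where "Q = R \<circ> inv_into E U"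
  have R: "unitary_between E F' R"
    unfolding R_def by (rule unitary_between_compose[OF W(1) V])
  have Q: "unitary_between E' F' Q"
    unfolding Q_def by (rule unitary_between_compose[OF unitary_between_inv_into[OF U E(1)] R])
  have QU: "Q (U x) = R x" if "x \<in> E" for x
    by (simp add: Q_def inv_into_f_f[OF unitary_between_inj_on[OF U E(1)] that])
  have WF: "W x \<in> F" if "x \<in> E" for x using W(1) that by (auto simp: unitary_between_def)
  have R_lin: "R (x + y) = R x + R y" "R (c *\<^sub>C x) = c *\<^sub>C R x" if "x \<in> E" "y \<in> E" for c x y
    using R that by (auto simp: unitary_between_def)
  have U_lin: "U (x + y) = U x + U y" "U (c *\<^sub>C x) = c *\<^sub>C U x" if "x \<in> E" "y \<in> E" for c x y
    using U that by (auto simp: unitary_between_def)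
  have RA: "R (A x) = p *\<^sub>C C' (R x)" if "x \<in> E" for x
    using C[OF WF[OF that]] W(2)[OF that] by (simp add: R_def)
  have RB: "R (B x) = q *\<^sub>C D' (R x) + r *\<^sub>C C' (R x)" if "x \<in> E" for x
    using D[OF WF[OF that]] W(3)[OF that] by (simp add: R_def)
  have inv: "inverse c *\<^sub>C c *\<^sub>C v = v" if "c \<noteq> 0" for c and v :: "'c::chilbert_space"
    using that by (simp add: scaleC_scaleC scaleC_one)
  note sc = complex_vector.subspace_scale[OF E(1)] and ad = complex_vector.subspace_add[OF E(1)]
  have QA: "Q (A' (U x)) = C' (Q (U x))" if x: "x \<in> E" for x
  proof -
    note Ax = E(2)[OF x]
    have "A' (U x) = U (inverse p *\<^sub>C A x)"
      by (simp add: U_lin(2)[OF Ax Ax] A[OF x] inv pq)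
    then have "Q (A' (U x)) = R (inverse p *\<^sub>C A x)" by (simp add: QU sc Ax)
    then show ?thesis by (simp add: R_lin(2)[OF Ax Ax] RA[OF x] inv pq QU x)
  qed
  have QB: "Q (B' (U x)) = D' (Q (U x))" if x: "x \<in> E" for x
  proof -
    note Ax = E(2)[OF x] and Bx = E(3)[OF x]
    define y where "y = inverse q *\<^sub>C (B x + (- r * inverse p) *\<^sub>C A x)"
    have s: "(- r * inverse p) *\<^sub>C A x \<in> E" by (rule sc[OF Ax])
    have t: "B x + (- r * inverse p) *\<^sub>C A x \<in> E" by (rule ad[OF Bx s])
    have y: "y \<in> E" unfolding y_def by (rule sc[OF t])
    have c: "(- r * inverse p) *\<^sub>C p *\<^sub>C v = - (r *\<^sub>C v)" for v :: "'c::chilbert_space"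
      using pq by (simp add: scaleC_scaleC complex_vector.scale_minus_left)
    have "U y = B' (U x)"
      unfolding y_def U_lin(2)[OF t t] U_lin(1)[OF Bx s] U_lin(2)[OF Ax Ax] A[OF x] B[OF x] c
      by (simp add: inv pq)
    moreover have "R y = D' (R x)"
      unfolding y_def R_lin(2)[OF t t] R_lin(1)[OF Bx s] R_lin(2)[OF Ax Ax] RA[OF x] RB[OF x] c
      by (simp add: inv pq)
    ultimately show ?thesis using QU[OF y] QU[OF x] by simp
  qed
  have "U ` E = E'" using U by (simp add: unitary_between_def)
  then have "\<forall>y\<in>E'. Q (A' y) = C' (Q y) \<and> Q (B' y) = D' (Q y)" using QA QB by blast
  then show ?thesis using Q unfolding simultaneously_unitarily_equivalent_def by blast
qed

lemma curvature_in_eigenspace: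
  fixes T :: "'a::chilbert_space \<Rightarrow> 'a"
  assumes "T \<in> cowen_douglas CARD('n::finite) \<Omega>" "open \<Omega>" "z \<in> \<Omega>"
  shows "curvature TYPE('n) \<Omega> T z x \<in> eigenspace T z"
    and "curvature_dbar TYPE('n) \<Omega> T z x \<in> eigenspace T z"
proof -
  define \<gamma> where "\<gamma> = (SOME \<gamma> :: 'n \<Rightarrow> complex \<Rightarrow> 'a. local_frame \<Omega> T z \<gamma>)"
  have "local_frame \<Omega> T z \<gamma>"
    unfolding \<gamma>_def by (rule someI_ex[OF exists_local_frame[OF assms]])
  then have "complex_vector.span (range (\<lambda>i. \<gamma> i z)) = eigenspace T z"
    unfolding local_frame_def by blast
  then have "frame_operator \<gamma> z M x \<in> eigenspace T z" for M
    using frame_operator_in_span[of \<gamma> z M x] by simp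
  then show "curvature TYPE('n) \<Omega> T z x \<in> eigenspace T z"
    "curvature_dbar TYPE('n) \<Omega> T z x \<in> eigenspace T z"
    by (simp_all add: curvature_def curvature_dbar_def Let_def flip: \<gamma>_def)
qed

lemma homogeneous_curvature_equivalence:
  fixes T1 :: "'a::chilbert_space \<Rightarrow> 'a"
    and T2 :: "'b::chilbert_space \<Rightarrow> 'b"
  assumes T1: "T1 \<in> cowen_douglas CARD('n::finite) (ball 0 1)" "homogeneous T1"
    and T2: "T2 \<in> cowen_douglas CARD('n) (ball 0 1)" "homogeneous T2"
    and eq: "simultaneously_unitarily_equivalent
           (eigenspace T1 0) (curvature TYPE('n) (ball 0 1) T1 0)
             (curvature_dbar TYPE('n) (ball 0 1) T1 0)
           (eigenspace T2 0) (curvature TYPE('n) (ball 0 1) T2 0)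
             (curvature_dbar TYPE('n) (ball 0 1) T2 0)"
    and z: "z \<in> ball 0 1"
  shows "simultaneously_unitarily_equivalent
           (eigenspace T1 z) (curvature TYPE('n) (ball 0 1) T1 z)
             (curvature_dbar TYPE('n) (ball 0 1) T1 z)
           (eigenspace T2 z) (curvature TYPE('n) (ball 0 1) T2 z)
             (curvature_dbar TYPE('n) (ball 0 1) T2 z)"
proof -
  define \<phi> where "\<phi> = Moebius_function 0 (- z)"
  have \<phi>: "disc_automorphism \<phi>" and \<phi>0: "\<phi> 0 = z"
    unfolding \<phi>_def using disc_automorphism_Moebius[OF z] by auto
  have "deriv \<phi> 0 \<noteq> 0"
    using \<phi> holomorphic_injective_imp_regular[of \<phi> "ball 0 1" 0]
    by (auto simp: disc_automorphism_def bij_betw_def)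
  then have pq: "cnj (deriv \<phi> 0) * deriv \<phi> 0 \<noteq> 0" "(cnj (deriv \<phi> 0))\<^sup>2 * deriv \<phi> 0 \<noteq> 0"
    by simp_all
  have 0: "0 \<in> ball (0::complex) 1" by simp
  obtain U where U: "unitary_between (eigenspace T1 0) (eigenspace T1 z) U"
    "\<And>x. x \<in> eigenspace T1 0 \<Longrightarrow> U (curvature TYPE('n) (ball 0 1) T1 0 x) =
      (cnj (deriv \<phi> 0) * deriv \<phi> 0) *\<^sub>C curvature TYPE('n) (ball 0 1) T1 z (U x)"
    "\<And>x. x \<in> eigenspace T1 0 \<Longrightarrow> U (curvature_dbar TYPE('n) (ball 0 1) T1 0 x) =
      ((cnj (deriv \<phi> 0))\<^sup>2 * deriv \<phi> 0) *\<^sub>C curvature_dbar TYPE('n) (ball 0 1) T1 z (U x) +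
      (cnj (deriv (deriv \<phi>) 0) * deriv \<phi> 0) *\<^sub>C curvature TYPE('n) (ball 0 1) T1 z (U x)"
    by (rule curvature_transport[OF T1 \<phi>, unfolded \<phi>0]) (rule that)
  obtain V where V: "unitary_between (eigenspace T2 0) (eigenspace T2 z) V"
    "\<And>x. x \<in> eigenspace T2 0 \<Longrightarrow> V (curvature TYPE('n) (ball 0 1) T2 0 x) =
      (cnj (deriv \<phi> 0) * deriv \<phi> 0) *\<^sub>C curvature TYPE('n) (ball 0 1) T2 z (V x)"
    "\<And>x. x \<in> eigenspace T2 0 \<Longrightarrow> V (curvature_dbar TYPE('n) (ball 0 1) T2 0 x) =
      ((cnj (deriv \<phi> 0))\<^sup>2 * deriv \<phi> 0) *\<^sub>C curvature_dbar TYPE('n) (ball 0 1) T2 z (V x) +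
      (cnj (deriv (deriv \<phi>) 0) * deriv \<phi> 0) *\<^sub>C curvature TYPE('n) (ball 0 1) T2 z (V x)"
    by (rule curvature_transport[OF T2 \<phi>, unfolded \<phi>0]) (rule that)
  have "complex_vector.subspace (eigenspace T1 0)"
    using T1(1) by (intro subspace_eigenspace) (simp add: cowen_douglas_def)
  then show ?thesis
    by (rule simultaneously_unitarily_equivalent_transport[
          where A = "curvature TYPE('n) (ball 0 1) T1 0" and B = "curvature_dbar TYPE('n) (ball 0 1) T1 0"
            and C = "curvature TYPE('n) (ball 0 1) T2 0" and D = "curvature_dbar TYPE('n) (ball 0 1) T2 0"
            and A' = "curvature TYPE('n) (ball 0 1) T1 z" and B' = "curvature_dbar TYPE('n) (ball 0 1) T1 z"
            and C' = "curvature TYPE('n) (ball 0 1) T2 z" and D' = "curvature_dbar TYPE('n) (ball 0 1) T2 z"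
            and U = U and V = V,
          OF eq _ curvature_in_eigenspace[OF T1(1) open_ball 0] U(1) V(1) U(2,3) V(2,3) pq])
qed

theorem theorem2p6:
  fixes T1 :: "'a::chilbert_space \<Rightarrow> 'a"
    and T2 :: "'b::chilbert_space \<Rightarrow> 'b"
  assumes "T1 \<in> cowen_douglas CARD('n::finite) (ball 0 1)" and "homogeneous T1"
    and "T2 \<in> cowen_douglas CARD('n) (ball 0 1)" and "homogeneous T2"
  shows "simultaneously_unitarily_equivalent
           (eigenspace T1 0) (curvature TYPE('n) (ball 0 1) T1 0)
             (curvature_dbar TYPE('n) (ball 0 1) T1 0)
           (eigenspace T2 0) (curvature TYPE('n) (ball 0 1) T2 0)
             (curvature_dbar TYPE('n) (ball 0 1) T2 0) \<longleftrightarrow>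
         (\<forall>z\<in>ball 0 1. simultaneously_unitarily_equivalent
           (eigenspace T1 z) (curvature TYPE('n) (ball 0 1) T1 z)
             (curvature_dbar TYPE('n) (ball 0 1) T1 z)
           (eigenspace T2 z) (curvature TYPE('n) (ball 0 1) T2 z)
             (curvature_dbar TYPE('n) (ball 0 1) T2 z))" (is "?L \<longleftrightarrow> ?R")
proof
  assume ?L
  then show ?R by (intro ballI) (rule homogeneous_curvature_equivalence[OF assms])
next
  assume ?R
  then show ?L by (rule bspec) simp
qed

end
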